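(* Let $\mathcal{R}=\mathbb{C}[\partial]A\oplus\mathbb{C}[\partial]B$ be the rank two Lie conformal algebra of Type I, let $V_{\alpha,\beta,\phi}=\mathbb{C}[\partial]v$ be a nontrivial finite irreducible $\mathcal{R}$-module and let $\eta\in\mathbb{C}$. Consider extensions of $\mathcal{R}$-modules of the form $$0\longrightarrow\mathbb{C}c_\eta\longrightarrow E\longrightarrow V_{\alpha,\beta,\phi}\longrightarrow0 .\qquad(\ast)$$ Every such $E$ is, as a vector space, $\mathbb{C}c_\eta\oplus\mathbb{C}[\partial]v$ with $\mathcal{R}_\lambda c_\eta=0$, $\partial c_\eta=\eta c_\eta$ and $$A_\lambda v=\delta_1(\partial+\alpha\lambda+\beta)v+f(\lambda)c_\eta,\qquad B_\lambda v=\delta_2\phi(\lambda)v+g(\lambda)c_\eta\qquad(\ast\ast)$$ for some $f(\lambda),g(\lambda)\in\mathbb{C}[\lambda]$. Nontrivial extensions of the form $(\ast)$ exist only when $(\delta_1,\delta_2)=(1,0)$, $\alpha\in\{1,2\}$, $\beta+\eta=0$. Moreover, they are given (up to equivalence) by $(\ast\ast)$ with $g(\lambda)=0$ and $f(\lambda)=s_1\lambda^2$ if $\alpha=1$, $f(\lambda)=s_2\lambda^3$ if $\alpha=2$, with nonzero constants $s_1,s_2$. In these cases, $\dim\mathrm{Ext}(V_{\alpha,\beta,\phi},\mathbb{C}c_\eta)=1$.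
   Context: Everything is over $\mathbb{C}$. A Lie conformal algebra $\mathcal{R}$ is a $\mathbb{C}[\partial]$-module with a $\mathbb{C}$-linear $\lambda$-bracket $\mathcal{R}\otimes\mathcal{R}\to\mathcal{R}[\lambda]$, $a\otimes b\mapsto[a_\lambda b]$, satisfying $[\partial a_\lambda b]=-\lambda[a_\lambda b]$, $[a_\lambda\partial b]=(\partial+\lambda)[a_\lambda b]$, $[a_\lambda b]=-[b_{-\lambda-\partial}a]$ and $[a_\lambda[b_\mu c]]=[[a_\lambda b]_{\lambda+\mu}c]+[b_\mu[a_\lambda c]]$. A conformal $\mathcal{R}$-module $V$ is a $\mathbb{C}[\partial]$-module with a $\mathbb{C}$-linear map $\mathcal{R}\otimes V\to V[\lambda]$, $a\otimes v\mapsto a_\lambda v$, satisfying $(\partial a)_\lambda v=-\lambda(a_\lambda v)$, $a_\lambda(\partial v)=(\partial+\lambda)a_\lambda v$, $a_\lambda(b_\mu v)=[a_\lambda b]_{\lambda+\mu}v+b_\mu(a_\lambda v)$. For $\eta\in\mathbb{C}$, $\mathbb{C}c_\eta$ is the one-dimensional module with $\partial c_\eta=\eta c_\eta$ and $\mathcal{R}_\lambda c_\eta=0$. An extension of $W$ by $V$ is an exact sequence of modules $0\to V\to E\to W\to0$. Two extensions $E,E'$ are equivalent if there is a module homomorphism $E\to E'$ compatible with the identity maps of $V$ and $W$. An extension is trivial if it is equivalent to $V\oplus W$. $\mathrm{Ext}(W,V)$ is the vector space of extension cocycles modulo those equivalent to the trivial extension, and $\dim\mathrm{Ext}(W,V)$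 is its dimension. The Lie conformal algebra of Type I is the direct sum of the Virasoro conformal algebra and a rank one commutative one: it has free basis $\{A,B\}$ over $\mathbb{C}[\partial]$ with $[A_\lambda A]=(\partial+2\lambda)A$, $[A_\lambda B]=0$, $[B_\lambda B]=0$. Its nontrivial finite irreducible modules are $V_{\alpha,\beta,\phi}=\mathbb{C}[\partial]v$ (free of rank one) with $A_\lambda v=\delta_1(\partial+\alpha\lambda+\beta)v$, $B_\lambda v=\delta_2\phi(\lambda)v$, where $\delta_1,\delta_2\in\{0,1\}$, $\delta_1^2+\delta_2^2=1$, $\beta\in\mathbb{C}$, $0\neq\alpha\in\mathbb{C}$, and $\phi\in\mathbb{C}[\lambda]$ is a nonzero polynomial. *)

theory Defs
  imports
    Complex_Main
    "HOL-Computational_Algebra.Polynomial"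
    "HOL-Library.Product_Plus"
    "HOL-Algebra.AbelCoset"
    "Jordan_Normal_Form.VS_Connect"
begin

text \<open>
  A module over \<open>\<complex>[\<partial>]\<close> is a module over the ring \<^typ>\<open>complex poly\<close> in the sense of the locale
  \<^locale>\<open>Modules.module\<close>: the scalar \<open>c\<close> acts as \<open>[:c:]\<close> and \<open>\<partial>\<close> acts as \<open>[:0, 1:]\<close>, so that for
  instance \<open>\<partial> + \<lambda>\<close> is \<open>[:\<lambda>, 1:]\<close>. Elements of \<open>M[\<lambda>]\<close> are polynomials of type \<open>'m poly\<close>.
\<close>

record (overloaded) 'r::zero conf_alg =
  ascale :: "complex poly \<Rightarrow> 'r \<Rightarrow> 'r"
  abracket :: "'r \<Rightarrow> 'r \<Rightarrow> 'r poly"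

record (overloaded) ('r, 'm::zero) conf_mod =
  mscale :: "complex poly \<Rightarrow> 'm \<Rightarrow> 'm"
  maction :: "'r \<Rightarrow> 'm \<Rightarrow> 'm poly"

definition lam_subst ::
  "(complex poly \<Rightarrow> 'm::ab_group_add \<Rightarrow> 'm) \<Rightarrow> 'm poly \<Rightarrow> complex poly \<Rightarrow> 'm" where
  \<comment> \<open>The polynomial \<open>\<Sum>i. \<lambda>^i m_i\<close> with \<open>u(\<partial>)\<close> substituted for \<open>\<lambda>\<close>, powers of \<open>u(\<partial>)\<close> standing on
    the left of the coefficients. Substituting \<open>[:l:]\<close> is evaluation at the number \<open>l\<close>;
    substituting \<open>[:- l, -1:]\<close> replaces \<open>\<lambda>\<close> by \<open>- l - \<partial>\<close>.\<close>
  "lam_subst s P u = (\<Sum>i\<le>degree P. s (u ^ i) (coeff P i))"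

lemma lam_subst_eq_imp_eq:
  fixes s :: "complex poly \<Rightarrow> 'm::ab_group_add \<Rightarrow> 'm"
  assumes s: "Modules.module s"
    and eq: "\<And>l. lam_subst s P [:l:] = lam_subst s Q [:l:]"
  shows "P = Q"
proof -
  interpret Modules.module s by (rule s)
  have scale_const: "s [:a:] (s [:b:] x) = s [:a * b:] x" for a b x
    by (simp add: mult.commute)
  have coeffs_0: "\<forall>i\<le>n. d i = 0" if "\<And>l. (\<Sum>i\<le>n. s [:l ^ i:] (d i)) = 0" for n d
    using that
  proof (induction n arbitrary: d)
    case 0
    from "0.prems"[of 1] show ?case by (simp add: one_pCons [symmetric])
  next
    case (Suc n)
    have "(\<Sum>i\<le>n. s [:l ^ i:] (s [:2 ^ i - 2 ^ Suc n:] (d i))) = 0" for l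
    proof -
      have "(\<Sum>i\<le>n. s [:l ^ i:] (s [:2 ^ i - 2 ^ Suc n:] (d i))) =
          (\<Sum>i\<le>Suc n. s [:l ^ i:] (s [:2 ^ i - 2 ^ Suc n:] (d i)))"
        by simp
      also have "\<dots> = (\<Sum>i\<le>Suc n. s [:(2 * l) ^ i:] (d i) - s [:2 ^ Suc n:] (s [:l ^ i:] (d i)))"
        by (intro sum.cong refl)
          (simp only: scale_const scale_left_diff_distrib [symmetric] power_mult_distrib
            diff_pCons right_diff_distrib diff_0_right mult.commute)
      also have "\<dots> = (\<Sum>i\<le>Suc n. s [:(2 * l) ^ i:] (d i)) -
          s [:2 ^ Suc n:] (\<Sum>i\<le>Suc n. s [:l ^ i:] (d i))"
        by (simp only: sum_subtractf scale_sum_right)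
      also have "\<dots> = 0"
        by (simp only: Suc.prems scale_zero_right diff_0_right)
      finally show ?thesis .
    qed
    then have z: "s [:2 ^ i - 2 ^ Suc n:] (d i) = 0" if "i \<le> n" for i
      using Suc.IH [of "\<lambda>i. s [:2 ^ i - 2 ^ Suc n:] (d i)"] that by blast
    have le: "d i = 0" if "i \<le> n" for i
    proof -
      have "(2::complex) ^ i \<noteq> 2 ^ Suc n"
      proof
        assume "(2::complex) ^ i = 2 ^ Suc n"
        then have "cmod (2 ^ i) = cmod (2 ^ Suc n)" by simp
        then have "(2::real) ^ i = 2 ^ Suc n" by (simp only: norm_power norm_numeral)
        with that show False by (simp only: power_inject_exp)
      qed
      then have "s [:inverse (2 ^ i - 2 ^ Suc n):] (s [:2 ^ i - 2 ^ Suc n:] (d i)) = d i"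
        by (simp only: scale_const) (simp add: one_pCons [symmetric])
      with z [OF that] show ?thesis by (simp only: scale_zero_right)
    qed
    from Suc.prems[of 1] le have "d (Suc n) = 0" by (simp add: one_pCons [symmetric])
    with le show ?case by (auto simp: le_Suc_eq)
  qed
  define n where "n = max (degree P) (degree Q)"
  have lam: "lam_subst s T [:l:] = (\<Sum>i\<le>n. s [:l ^ i:] (coeff T i))" if "degree T \<le> n" for T l
    unfolding lam_subst_def poly_const_pow using that
    by (intro sum.mono_neutral_left) (auto simp: coeff_eq_0)
  have "\<forall>i\<le>n. coeff P i - coeff Q i = 0"
    using eq by (intro coeffs_0) (simp add: scale_right_diff_distrib sum_subtractf lam n_def)
  then have "coeff P i = coeff Q i" for i
    by (cases "i \<le> n") (auto simp: n_def coeff_eq_0)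
  then show ?thesis by (simp add: poly_eq_iff)
qed

text \<open>
  \<open>bracket R a l b\<close> is the value of \<open>[a\<^sub>\<lambda> b]\<close>, and \<open>action V a l v\<close> that of \<open>a\<^sub>\<lambda> v\<close>, at \<open>\<lambda> = l\<close>.
  The axioms below are identities between polynomials in \<open>\<lambda>\<close> (and \<open>\<mu>\<close>) with coefficients in a complex
  vector space; they are required at all complex values \<open>l\<close> (and \<open>m\<close>), which is the same
  (see \<open>lam_subst_eq_imp_eq\<close>).
\<close>

definition bracket :: "'r::ab_group_add conf_alg \<Rightarrow> 'r \<Rightarrow> complex \<Rightarrow> 'r \<Rightarrow> 'r" where
  "bracket R a l b = lam_subst (ascale R) (abracket R a b) [:l:]"

definition action :: "('r, 'm::ab_group_add) conf_mod \<Rightarrow> 'r \<Rightarrow> complex \<Rightarrow> 'm \<Rightarrow> 'm" where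
  "action V a l v = lam_subst (mscale V) (maction V a v) [:l:]"

locale lie_conformal_algebra =
  fixes R :: "'r::ab_group_add conf_alg"
  assumes module_R: "Modules.module (ascale R)"
    and bracket_linear_left:
      "Vector_Spaces.linear (\<lambda>c. ascale R [:c:]) (\<lambda>c. ascale R [:c:]) (\<lambda>a. bracket R a l b)"
    and bracket_linear_right:
      "Vector_Spaces.linear (\<lambda>c. ascale R [:c:]) (\<lambda>c. ascale R [:c:]) (\<lambda>b. bracket R a l b)"
    and bracket_sesqui_left:
      "bracket R (ascale R [:0, 1:] a) l b = ascale R [:- l:] (bracket R a l b)"
    and bracket_sesqui_right:
      "bracket R a l (ascale R [:0, 1:] b) = ascale R [:l, 1:] (bracket R a l b)"
    and bracket_skew:
      "bracket R a l b = - lam_subst (ascale R) (abracket R b a) [:- l, -1:]"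
    and bracket_jacobi:
      "bracket R a l (bracket R b m c) =
        bracket R (bracket R a l b) (l + m) c + bracket R b m (bracket R a l c)"

locale conformal_module = lie_conformal_algebra R
  for R :: "'r::ab_group_add conf_alg" +
  fixes V :: "('r, 'v::ab_group_add) conf_mod"
  assumes module_V: "Modules.module (mscale V)"
    and action_linear_left:
      "Vector_Spaces.linear (\<lambda>c. ascale R [:c:]) (\<lambda>c. mscale V [:c:]) (\<lambda>a. action V a l v)"
    and action_linear_right:
      "Vector_Spaces.linear (\<lambda>c. mscale V [:c:]) (\<lambda>c. mscale V [:c:]) (\<lambda>v. action V a l v)"
    and action_sesqui_left:
      "action V (ascale R [:0, 1:] a) l v = mscale V [:- l:] (action V a l v)"
    and action_sesqui_right:
      "action V a l (mscale V [:0, 1:] v) = mscale V [:l, 1:] (action V a l v)"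
    and action_jacobi:
      "action V a l (action V b m v) =
        action V (bracket R a l b) (l + m) v + action V b m (action V a l v)"

definition conf_hom ::
  "('r, 'v::ab_group_add) conf_mod \<Rightarrow> ('r, 'w::ab_group_add) conf_mod \<Rightarrow> ('v \<Rightarrow> 'w) \<Rightarrow> bool" where
  "conf_hom V W h \<longleftrightarrow>
    Modules.module_hom (mscale V) (mscale W) h \<and>
    (\<forall>a l v. h (action V a l v) = action W a l (h v))"

definition one_dim_mod :: "complex \<Rightarrow> ('r, complex) conf_mod" where
  \<comment> \<open>The module \<open>\<complex>c\<^sub>\<eta>\<close>, with \<open>c\<^sub>\<eta> = 1\<close>.\<close>
  "one_dim_mod \<eta> = \<lparr>mscale = (\<lambda>p x. poly p \<eta> * x), maction = (\<lambda>a x. 0)\<rparr>"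

definition pair_poly :: "'v::ab_group_add poly \<Rightarrow> 'w::ab_group_add poly \<Rightarrow> ('v \<times> 'w) poly" where
  \<comment> \<open>The identification of \<open>V[\<lambda>] \<oplus> W[\<lambda>]\<close> with \<open>(V \<oplus> W)[\<lambda>]\<close>.\<close>
  "pair_poly P Q = map_poly (\<lambda>x. (x, 0)) P + map_poly (\<lambda>w. (0, w)) Q"

definition direct_sum_mod ::
  "('r, 'v::ab_group_add) conf_mod \<Rightarrow> ('r, 'w::ab_group_add) conf_mod \<Rightarrow> ('r, 'v \<times> 'w) conf_mod"
where
  "direct_sum_mod V W =
    \<lparr>mscale = (\<lambda>p (x, w). (mscale V p x, mscale W p w)),
     maction = (\<lambda>a (x, w). pair_poly (maction V a x) (maction W a w))\<rparr>"


subsection \<open>Extensions\<close>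

text \<open>\<open>0 \<rightarrow> V \<rightarrow> E \<rightarrow> W \<rightarrow> 0\<close>, with maps \<open>i\<close> and \<open>p\<close>.\<close>

definition extension ::
  "'r::ab_group_add conf_alg \<Rightarrow> ('r, 'v::ab_group_add) conf_mod \<Rightarrow> ('r, 'w::ab_group_add) conf_mod \<Rightarrow>
    ('r, 'e::ab_group_add) conf_mod \<Rightarrow> ('v \<Rightarrow> 'e) \<Rightarrow> ('e \<Rightarrow> 'w) \<Rightarrow> bool" where
  "extension R V W E i p \<longleftrightarrow>
    conformal_module R V \<and> conformal_module R E \<and> conformal_module R W \<and>
    conf_hom V E i \<and> conf_hom E W p \<and>
    inj i \<and> range i = {e. p e = 0} \<and> surj p"

definition ext_equivalent ::
  "('r, 'e::ab_group_add) conf_mod \<Rightarrow> ('v \<Rightarrow> 'e) \<Rightarrow> ('e \<Rightarrow> 'w) \<Rightarrow>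
    ('r, 'f::ab_group_add) conf_mod \<Rightarrow> ('v \<Rightarrow> 'f) \<Rightarrow> ('f \<Rightarrow> 'w) \<Rightarrow> bool" where
  "ext_equivalent E i p E' i' p' \<longleftrightarrow>
    (\<exists>h. conf_hom E E' h \<and> (\<forall>x. h (i x) = i' x) \<and> (\<forall>e. p' (h e) = p e))"

definition ext_trivial ::
  "('r, 'v::ab_group_add) conf_mod \<Rightarrow> ('r, 'w::ab_group_add) conf_mod \<Rightarrow>
    ('r, 'e::ab_group_add) conf_mod \<Rightarrow> ('v \<Rightarrow> 'e) \<Rightarrow> ('e \<Rightarrow> 'w) \<Rightarrow> bool" where
  "ext_trivial V W E i p \<longleftrightarrow>
    ext_equivalent E i p (direct_sum_mod V W) (\<lambda>x. (x, 0)) snd"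


subsection \<open>The space Ext\<close>

text \<open>
  A pair \<open>(d, \<psi>)\<close> of maps twists the module structure of \<open>V \<oplus> W\<close> to
  \<open>p(\<partial>)(x, w) = (p(\<partial>)x + d p w, p(\<partial>)w)\<close> and \<open>a\<^sub>\<lambda>(x, w) = (a\<^sub>\<lambda>x + \<psi>\<^sub>\<lambda>(a, w), a\<^sub>\<lambda>w)\<close>.
\<close>

type_synonym ('r, 'v, 'w) ext_data = "(complex poly \<Rightarrow> 'w \<Rightarrow> 'v) \<times> ('r \<Rightarrow> 'w \<Rightarrow> 'v poly)"

definition twisted_mod ::
  "('r, 'v::ab_group_add) conf_mod \<Rightarrow> ('r, 'w::ab_group_add) conf_mod \<Rightarrow> ('r, 'v, 'w) ext_data \<Rightarrow>
    ('r, 'v \<times> 'w) conf_mod" where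
  "twisted_mod V W z =
    \<lparr>mscale = (\<lambda>p (x, w). (mscale V p x + fst z p w, mscale W p w)),
     maction = (\<lambda>a (x, w). pair_poly (maction V a x + snd z a w) (maction W a w))\<rparr>"

definition ext_cocycles ::
  "'r::ab_group_add conf_alg \<Rightarrow> ('r, 'w::ab_group_add) conf_mod \<Rightarrow> ('r, 'v::ab_group_add) conf_mod \<Rightarrow>
    ('r, 'v, 'w) ext_data set" where
  \<comment> \<open>The first condition says that \<open>E\<close> is \<open>V \<oplus> W\<close> as a complex vector space, so that \<open>d\<close> only records
    the twist of \<open>\<partial>\<close>.\<close>
  "ext_cocycles R W V =
    {z. (\<forall>c w. fst z [:c:] w = 0) \<and>
        extension R V W (twisted_mod V W z) (\<lambda>x. (x, 0)) snd}"

definition trivial_cocycles ::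
  "'r::ab_group_add conf_alg \<Rightarrow> ('r, 'w::ab_group_add) conf_mod \<Rightarrow> ('r, 'v::ab_group_add) conf_mod \<Rightarrow>
    ('r, 'v, 'w) ext_data set" where
  "trivial_cocycles R W V =
    {z \<in> ext_cocycles R W V. ext_trivial V W (twisted_mod V W z) (\<lambda>x. (x, 0)) snd}"

definition cocycle_space ::
  "'r::ab_group_add conf_alg \<Rightarrow> ('r, 'w::ab_group_add) conf_mod \<Rightarrow> ('r, 'v::ab_group_add) conf_mod \<Rightarrow>
    (complex, ('r, 'v, 'w) ext_data) module" where
  "cocycle_space R W V =
    \<lparr>carrier = ext_cocycles R W V, mult = undefined, one = undefined,
     zero = (\<lambda>q w. 0, \<lambda>a w. 0),
     add = (\<lambda>z z'. (\<lambda>q w. fst z q w + fst z' q w, \<lambda>a w. snd z a w + snd z' a w)),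
     smult = (\<lambda>c z. (\<lambda>q w. mscale V [:c:] (fst z q w),
                     \<lambda>a w. map_poly (mscale V [:c:]) (snd z a w)))\<rparr>"

definition quotient_space :: "('k, 'm) module \<Rightarrow> 'm set \<Rightarrow> ('k, 'm set) module" where
  "quotient_space M N =
    \<lparr>carrier = A_RCOSETS M N, mult = undefined, one = undefined,
     zero = N, add = set_add M,
     smult = (\<lambda>c X. \<Union>x\<in>X. a_r_coset M N (module.smult M c x))\<rparr>"

definition Ext_space ::
  "'r::ab_group_add conf_alg \<Rightarrow> ('r, 'w::ab_group_add) conf_mod \<Rightarrow> ('r, 'v::ab_group_add) conf_mod \<Rightarrow>
    (complex, ('r, 'v, 'w) ext_data set) module" where
  "Ext_space R W V = quotient_space (cocycle_space R W V) (trivial_cocycles R W V)"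


subsection \<open>The algebra of Type I and its rank one modules\<close>

definition type_I_algebra :: "'r::ab_group_add conf_alg \<Rightarrow> 'r \<Rightarrow> 'r \<Rightarrow> bool" where
  "type_I_algebra R A B \<longleftrightarrow>
    lie_conformal_algebra R \<and>
    A \<noteq> B \<and> \<not> Modules.module.dependent (ascale R) {A, B} \<and>
    Modules.module.span (ascale R) {A, B} = UNIV \<and>
    (\<forall>l. bracket R A l A = ascale R [:2 * l, 1:] A) \<and>
    (\<forall>l. bracket R A l B = 0) \<and>
    (\<forall>l. bracket R B l B = 0)"

definition type_I_module ::
  "'r::ab_group_add conf_alg \<Rightarrow> 'r \<Rightarrow> 'r \<Rightarrow> ('r, 'v::ab_group_add) conf_mod \<Rightarrow> 'v \<Rightarrow>
    complex \<Rightarrow> complex \<Rightarrow> complex \<Rightarrow> complex \<Rightarrow> complex poly \<Rightarrow> bool" where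
  \<comment> \<open>\<open>V\<close> is the module \<open>V\<^sub>\<alpha>\<^sub>,\<^sub>\<beta>\<^sub>,\<^sub>\<phi> = \<complex>[\<partial>]v\<close> over the algebra with basis \<open>{A, B}\<close>.\<close>
  "type_I_module R A B V v \<delta>\<^sub>1 \<delta>\<^sub>2 \<alpha> \<beta> \<phi> \<longleftrightarrow>
    conformal_module R V \<and>
    \<not> Modules.module.dependent (mscale V) {v} \<and> Modules.module.span (mscale V) {v} = UNIV \<and>
    \<delta>\<^sub>1 \<in> {0, 1} \<and> \<delta>\<^sub>2 \<in> {0, 1} \<and> \<delta>\<^sub>1\<^sup>2 + \<delta>\<^sub>2\<^sup>2 = 1 \<and> \<alpha> \<noteq> 0 \<and> \<phi> \<noteq> 0 \<and>
    (\<forall>l. action V A l v = mscale V [:\<delta>\<^sub>1 * (\<alpha> * l + \<beta>), \<delta>\<^sub>1:] v) \<and>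
    (\<forall>l. action V B l v = mscale V [:\<delta>\<^sub>2 * poly \<phi> l:] v)"

definition standard_form ::
  "'r \<Rightarrow> 'r \<Rightarrow> 'v \<Rightarrow> complex \<Rightarrow> complex \<Rightarrow> complex \<Rightarrow> complex \<Rightarrow> complex poly \<Rightarrow> complex \<Rightarrow>
    ('r, 'e::ab_group_add) conf_mod \<Rightarrow> (complex \<Rightarrow> 'e) \<Rightarrow> ('e \<Rightarrow> 'v) \<Rightarrow>
    complex poly \<Rightarrow> complex poly \<Rightarrow> bool" where
  \<comment> \<open>\<open>E = \<complex>c\<^sub>\<eta> \<oplus> \<complex>[\<partial>]v'\<close>, where \<open>c\<^sub>\<eta>\<close> is the image of the generator of \<open>\<complex>c\<^sub>\<eta>\<close> and \<open>v'\<close> is a lift of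
    the generator \<open>v\<close> of the quotient module.\<close>
  "standard_form A B v \<delta>\<^sub>1 \<delta>\<^sub>2 \<alpha> \<beta> \<phi> \<eta> E i p f g \<longleftrightarrow>
    (\<exists>c v'. c = i 1 \<and> p v' = v \<and>
      bij (\<lambda>(x, q). mscale E [:x:] c + mscale E q v') \<and>
      (\<forall>a l. action E a l c = 0) \<and>
      mscale E [:0, 1:] c = mscale E [:\<eta>:] c \<and>
      (\<forall>l. action E A l v' =
        mscale E [:\<delta>\<^sub>1 * (\<alpha> * l + \<beta>), \<delta>\<^sub>1:] v' + mscale E [:poly f l:] c) \<and>
      (\<forall>l. action E B l v' =
        mscale E [:\<delta>\<^sub>2 * poly \<phi> l:] v' + mscale E [:poly g l:] c))"

end

theory Submission
  imports Defs
begin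

text \<open>
  Let \<open>E\<close> be an extension of \<open>V\<close> by \<open>\<complex>c\<^sub>\<eta>\<close> and let \<open>v'\<close> be a preimage of the generator \<open>v\<close>. Since \<open>V\<close> is
  free, \<open>E = \<complex>c\<^sub>\<eta> \<oplus> \<complex>[\<partial>]v'\<close>, and \<open>A\<^sub>\<lambda> v'\<close> and \<open>B\<^sub>\<lambda> v'\<close> differ from the formulas in \<open>V\<close> by \<open>f(\<lambda>)c\<^sub>\<eta>\<close>
  and \<open>g(\<lambda>)c\<^sub>\<eta>\<close>. Sesquilinearity spreads these two polynomials to all of \<open>R\<close> and \<open>E\<close>
  (\<open>action_lift\<close>), so they determine the extension up to equivalence (\<open>equal_lifts_equivalent\<close>).
  The only freedom is the choice of the preimage: replacing \<open>v'\<close> by \<open>v' + k c\<^sub>\<eta>\<close> subtracts from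
  \<open>(f, g)\<close> the pair \<open>(k\<delta>\<^sub>1(b + \<alpha>\<lambda>), k\<delta>\<^sub>2\<phi>)\<close>, where \<open>b = \<beta> + \<eta>\<close> (\<open>lift_translate\<close>).

  The Jacobi identity on \<open>v'\<close> for the pairs of generators gives three equations (\<open>lift_equations\<close>).
  If \<open>\<delta>\<^sub>2 = 1\<close>, the pair \<open>A, B\<close> forces \<open>f = 0\<close> and the pair \<open>B, B\<close> makes \<open>g\<close> a multiple of \<open>\<phi>\<close>, so the
  extension is trivial. If \<open>\<delta>\<^sub>1 = 1\<close>, the pair \<open>A, B\<close> forces \<open>g = 0\<close>, and the pair \<open>A, A\<close> gives
  \<open>(b + \<lambda> + \<alpha>\<mu>) f(\<lambda>) - (b + \<mu> + \<alpha>\<lambda>) f(\<mu>) = (\<lambda> - \<mu>) f(\<lambda> + \<mu>)\<close>. Its Taylor expansion at \<open>\<mu> = 0\<close> to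
  second order leaves, besides the multiples of \<open>b + \<alpha>\<lambda>\<close> that a change of \<open>v'\<close> removes, only \<open>\<lambda>\<^sup>2\<close>
  for \<open>\<alpha> = 1\<close> and \<open>\<lambda>\<^sup>3\<close> for \<open>\<alpha> = 2\<close>, both with \<open>b = 0\<close> (\<open>virasoro_cocycle_polynomial\<close>).

  Conversely, if \<open>\<delta>\<^sub>1 = 1\<close>, a solution \<open>f\<close> with \<open>b = 0\<close> defines an extension in which \<open>P(\<partial>)A + Q(\<partial>)B\<close> sends
  \<open>q(\<partial>)v\<close> to the element of \<open>V\<close> plus \<open>P(-\<lambda>) f(\<lambda>) q(\<eta> + \<lambda>) c\<^sub>\<eta>\<close> (\<open>ext_cocycle_virasoro_twist\<close>).

  As for the dimension in these cases, on pairs \<open>(d, \<psi>)\<close> the module axioms are linear equations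
  (\<open>mem_ext_cocycles_iff\<close>), and the coefficient of \<open>\<lambda>\<^bsup>\<alpha>+1\<^esup>\<close> in \<open>\<psi>\<^sub>\<lambda>(A, v)\<close> is a linear functional on
  them. It does not see the choice of \<open>v'\<close>, it vanishes exactly on the trivial cocycles, and it
  takes the value 1 on the cocycle built from \<open>f = \<lambda>\<^bsup>\<alpha>+1\<^esup>\<close>, so it identifies \<open>Ext\<close> with \<open>\<complex>\<close>.
\<close>

section \<open>The functional equation of the Virasoro cocycles\<close>

text \<open>
  Here \<open>b + a\<lambda>\<close> itself is always a solution. Setting \<open>m = 0\<close> gives \<open>b f(l) = (b + a l) f(0)\<close>, which
  settles the case \<open>b \<noteq> 0\<close>. For \<open>b = 0\<close> the terms of order one and two in \<open>m\<close> are linear differential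
  equations in \<open>l\<close>: the former yields \<open>(a + 1 - n) c\<^sub>n = 0\<close> for \<open>n \<ge> 2\<close>, the latter
  \<open>n (3 - n) c\<^sub>n = 0\<close> for \<open>n \<ge> 3\<close>, where \<open>c\<^sub>n\<close> are the coefficients of \<open>f\<close>.
\<close>

lemma virasoro_cocycle_polynomial:
  fixes f :: "complex poly" and a b :: complex
  assumes a: "a \<noteq> 0"
    and eq: "\<And>l m. (b + l + a * m) * poly f l - (b + m + a * l) * poly f m =
      (l - m) * poly f (l + m)"
  shows "\<exists>k r. f = [:k * b, k * a:] + r \<and>
    (r = 0 \<or> b = 0 \<and> (\<exists>s. s \<noteq> 0 \<and> (a = 1 \<and> r = monom s 2 \<or> a = 2 \<and> r = monom s 3)))"
proof -
  have at_0: "b * poly f l = (b + a * l) * poly f 0" for l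
    using eq[of l 0] by (simp add: algebra_simps)
  show ?thesis
  proof (cases "b = 0")
    case False
    have "f = [:poly f 0 / b * b, poly f 0 / b * a:] + 0"
    proof (rule poly_ext)
      fix l
      show "poly f l = poly ([:poly f 0 / b * b, poly f 0 / b * a:] + 0) l"
        using at_0[of l] False by (simp add: field_simps)
    qed
    then show ?thesis by blast
  next
    case True
    have c0: "coeff f 0 = 0"
      using at_0[of 1] True a by (simp add: poly_0_coeff_0)
    have f0: "poly f 0 = 0" "poly (pderiv f) 0 = coeff f 1" "poly (pderiv (pderiv f)) 0 = 2 * coeff f 2"
      using c0 by (simp_all add: poly_0_coeff_0 coeff_pderiv numeral_2_eq_2)
    \<comment> \<open>The equation at a fixed \<open>l\<close>, as an identity of polynomials in \<open>m\<close>; \<open>d1\<close> and \<open>d2\<close> below are its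
      first and second derivatives at \<open>m = 0\<close>.\<close>
    have in_m: "[:l, a:] * [:poly f l:] - [:a * l, 1:] * f - [:l, -1:] * (f \<circ>\<^sub>p [:l, 1:]) = 0" for l
    proof (rule poly_ext)
      fix m
      show "poly ([:l, a:] * [:poly f l:] - [:a * l, 1:] * f - [:l, -1:] * (f \<circ>\<^sub>p [:l, 1:])) m = poly 0 m"
        using eq[of l m] True by (simp add: poly_pcompose algebra_simps)
    qed
    have d1: "Polynomial.smult (a + 1) f - [:0, a * coeff f 1:] - [:0, 1:] * pderiv f = 0"
    proof (rule poly_ext)
      fix l
      from in_m[of l] have "poly (pderiv ([:l, a:] * [:poly f l:] - [:a * l, 1:] * f -
          [:l, -1:] * (f \<circ>\<^sub>p [:l, 1:]))) 0 = 0" by (simp only: pderiv_0 poly_0)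
      then show "poly (Polynomial.smult (a + 1) f - [:0, a * coeff f 1:] - [:0, 1:] * pderiv f) l = poly 0 l"
        by (simp add: f0 pderiv_diff pderiv_add pderiv_minus pderiv_smult pderiv_mult pderiv_pCons pderiv_pcompose poly_pcompose)
          (simp add: algebra_simps)
    qed
    have d2: "Polynomial.smult 2 (pderiv f) - [:2 * coeff f 1, a * (2 * coeff f 2):] -
        [:0, 1:] * pderiv (pderiv f) = 0"
    proof (rule poly_ext)
      fix l
      from in_m[of l] have "poly (pderiv (pderiv ([:l, a:] * [:poly f l:] - [:a * l, 1:] * f -
          [:l, -1:] * (f \<circ>\<^sub>p [:l, 1:])))) 0 = 0" by (simp only: pderiv_0 poly_0)
      then show "poly (Polynomial.smult 2 (pderiv f) - [:2 * coeff f 1, a * (2 * coeff f 2):] -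
          [:0, 1:] * pderiv (pderiv f)) l = poly 0 l"
        by (simp add: pderiv_diff pderiv_add pderiv_minus pderiv_smult pderiv_mult pderiv_pCons pderiv_pcompose poly_pcompose f0)
          (simp add: algebra_simps)
    qed
    have first: "(a + 1 - of_nat n) * coeff f n = 0" if "n \<ge> 2" for n
      using arg_cong[OF d1, of "\<lambda>p. coeff p n"] that
      by (cases n; cases "n - 1") (auto simp: coeff_pderiv algebra_simps)
    have high: "coeff f n = 0" if "n \<ge> 4" for n
    proof -
      obtain j where j: "n = Suc (Suc (Suc j))" "j \<ge> 1"
        using \<open>n \<ge> 4\<close> by (intro that[of "n - 3"]) auto
      have "of_nat (Suc (Suc (Suc j))) * (2 - of_nat (Suc (Suc j))) * coeff f n = 0"
        using arg_cong[OF d2, of "\<lambda>p. coeff p (Suc (Suc j))"] j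
        by (simp add: coeff_pderiv algebra_simps)
      moreover have "(2 - of_nat (Suc (Suc j)) :: complex) \<noteq> 0"
        using j by simp
      moreover have "(of_nat (Suc (Suc (Suc j))) :: complex) \<noteq> 0"
        by (rule of_nat_neq_0)
      ultimately show ?thesis by simp
    qed
    have f_eq: "f = [:0, coeff f 1:] + monom (coeff f 2) 2 + monom (coeff f 3) 3"
    proof (rule poly_eqI)
      fix n :: nat
      consider "n = 0" | "n = 1" | "n = 2" | "n = 3" | "n \<ge> 4" by linarith
      then show "coeff f n =
          coeff ([:0, coeff f 1:] + monom (coeff f 2) 2 + monom (coeff f 3) 3) n"
        by cases (simp_all add: c0 high coeff_pCons numeral_2_eq_2 numeral_3_eq_3 split: nat.split)
    qed
    have c2: "coeff f 2 = 0 \<or> a = 1" and c3: "coeff f 3 = 0 \<or> a = 2"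
      using first[of 2] first[of 3] by (auto simp: algebra_simps)
    define r where "r = monom (coeff f 2) 2 + monom (coeff f 3) 3"
    have "f = [:coeff f 1 / a * b, coeff f 1 / a * a:] + r"
      using f_eq a True by (simp add: r_def add.assoc)
    moreover have "r = 0 \<or> b = 0 \<and>
        (\<exists>s. s \<noteq> 0 \<and> (a = 1 \<and> r = monom s 2 \<or> a = 2 \<and> r = monom s 3))"
      using c2 c3 True unfolding r_def
      by (cases "coeff f 2 = 0"; cases "coeff f 3 = 0") auto
    ultimately show ?thesis by blast
  qed
qed

lemma virasoro_cocycle_monom:
  fixes a s l m :: complex
  assumes "a = 1 \<and> f = monom s 2 \<or> a = 2 \<and> f = monom s 3"
  shows "(l + a * m) * poly f l - (m + a * l) * poly f m = (l - m) * poly f (l + m)"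
  using assms by (auto simp: poly_monom algebra_simps power2_eq_square power3_eq_cube)

section \<open>Quotients by the kernel of a linear functional\<close>

text \<open>
  The cosets of the kernel \<open>N\<close> of a functional \<open>L\<close> are its level sets, and \<open>c \<mapsto> L\<^sup>-\<^sup>1(c)\<close> is an
  isomorphism from the field onto the quotient. It is used to read off the dimension of \<open>Ext\<close>.
\<close>

lemma vectorspace_onto_class_ring:
  fixes L :: "'m \<Rightarrow> 'k::field"
  assumes M: "Module.module class_ring M"
    and add: "\<And>x y. x \<in> carrier M \<Longrightarrow> y \<in> carrier M \<Longrightarrow> L (x \<oplus>\<^bsub>M\<^esub> y) = L x + L y"
    and smult: "\<And>c x. x \<in> carrier M \<Longrightarrow> L (c \<odot>\<^bsub>M\<^esub> x) = c * L x"
    and x\<^sub>0: "x\<^sub>0 \<in> carrier M" "L x\<^sub>0 = 1"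
    and N: "N = {x \<in> carrier M. L x = 0}"
  shows "vectorspace class_ring (quotient_space M N)"
    and "vectorspace.fin_dim class_ring (quotient_space M N)"
    and "vectorspace.dim class_ring (quotient_space M N) = 1"
proof -
  interpret M: Module.module class_ring M by (rule M)
  define F where "F c = {x \<in> carrier M. L x = c}" for c
  have F_ne: "c \<odot>\<^bsub>M\<^esub> x\<^sub>0 \<in> F c" for c
    using x\<^sub>0 smult by (simp add: F_def)
  have inj_F: "F c = F d \<longleftrightarrow> c = d" for c d
    using F_ne[of c] by (auto simp: F_def)
  have L_neg: "L (\<ominus>\<^bsub>M\<^esub> x) = - L x" if "x \<in> carrier M" for x
  proof -
    have "L (x \<oplus>\<^bsub>M\<^esub> \<ominus>\<^bsub>M\<^esub> x) = L x + L (\<ominus>\<^bsub>M\<^esub> x)" using that by (simp add: add)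
    moreover have "L \<zero>\<^bsub>M\<^esub> = 0" using add[of "\<zero>\<^bsub>M\<^esub>" "\<zero>\<^bsub>M\<^esub>"]
      by (metis M.r_zero M.zero_closed add_cancel_right_right)
    ultimately show ?thesis using that by (simp add: M.r_neg add_eq_0_iff)
  qed
  have coset: "a_r_coset M N x = F (L x)" if "x \<in> carrier M" for x
  proof
    show "a_r_coset M N x \<subseteq> F (L x)"
      using that by (auto simp: a_r_coset_def' N F_def add)
    show "F (L x) \<subseteq> a_r_coset M N x"
    proof
      fix y assume "y \<in> F (L x)"
      then have y: "y \<in> carrier M" "L y = L x" by (auto simp: F_def)
      have "y \<oplus>\<^bsub>M\<^esub> \<ominus>\<^bsub>M\<^esub> x \<in> N" using y that by (simp add: N add L_neg)
      moreover have "y = (y \<oplus>\<^bsub>M\<^esub> \<ominus>\<^bsub>M\<^esub> x) \<oplus>\<^bsub>M\<^esub> x"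
        using y that by (simp add: M.a_assoc M.l_neg)
      ultimately show "y \<in> a_r_coset M N x" by (auto simp: a_r_coset_def')
    qed
  qed
  let ?Q = "quotient_space M N"
  have carrier_Q: "carrier ?Q = range F"
  proof -
    have "carrier ?Q = {F (L x) |x. x \<in> carrier M}"
      using coset by (auto simp: quotient_space_def A_RCOSETS_def')
    also have "\<dots> = range F"
    proof -
      have "F c = F (L (c \<odot>\<^bsub>M\<^esub> x\<^sub>0))" "c \<odot>\<^bsub>M\<^esub> x\<^sub>0 \<in> carrier M" for c
        using F_ne[of c] by (simp_all add: F_def)
      then show ?thesis by blast
    qed
    finally show ?thesis .
  qed
  have zero_Q: "\<zero>\<^bsub>?Q\<^esub> = F 0" by (simp add: quotient_space_def N F_def)
  have add_Q: "F c \<oplus>\<^bsub>?Q\<^esub> F d = F (c + d)" for c d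
  proof -
    have "F c \<oplus>\<^bsub>?Q\<^esub> F d = {x \<oplus>\<^bsub>M\<^esub> y |x y. x \<in> F c \<and> y \<in> F d}"
      by (auto simp: quotient_space_def set_add_def')
    also have "\<dots> = F (c + d)"
    proof
      show "{x \<oplus>\<^bsub>M\<^esub> y |x y. x \<in> F c \<and> y \<in> F d} \<subseteq> F (c + d)"
        by (auto simp: F_def add)
      show "F (c + d) \<subseteq> {x \<oplus>\<^bsub>M\<^esub> y |x y. x \<in> F c \<and> y \<in> F d}"
      proof
        fix z assume z: "z \<in> F (c + d)"
        let ?x = "c \<odot>\<^bsub>M\<^esub> x\<^sub>0"
        have x: "?x \<in> carrier M" "L ?x = c" using F_ne[of c] by (auto simp: F_def)
        have "\<ominus>\<^bsub>M\<^esub> ?x \<oplus>\<^bsub>M\<^esub> z \<in> F d" using z x by (simp add: F_def add L_neg)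
        moreover have "z = ?x \<oplus>\<^bsub>M\<^esub> (\<ominus>\<^bsub>M\<^esub> ?x \<oplus>\<^bsub>M\<^esub> z)"
          using z x by (simp add: F_def M.a_assoc[symmetric] M.r_neg)
        ultimately show "z \<in> {x \<oplus>\<^bsub>M\<^esub> y |x y. x \<in> F c \<and> y \<in> F d}"
          using F_ne[of c] by blast
      qed
    qed
    finally show ?thesis .
  qed
  have smult_Q: "c \<odot>\<^bsub>?Q\<^esub> F d = F (c * d)" for c d
  proof -
    have "c \<odot>\<^bsub>?Q\<^esub> F d = (\<Union>x\<in>F d. a_r_coset M N (c \<odot>\<^bsub>M\<^esub> x))" by (simp add: quotient_space_def)
    also have "\<dots> = (\<Union>x\<in>F d. F (c * d))"
      by (intro SUP_cong refl) (auto simp: coset F_def smult)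
    also have "\<dots> = F (c * d)" using F_ne[of d] by blast
    finally show ?thesis .
  qed
  have ab: "abelian_group ?Q"
  proof (rule abelian_groupI)
    fix x assume "x \<in> carrier ?Q"
    then obtain c where c: "x = F c" by (auto simp: carrier_Q)
    have "F (- c) \<oplus>\<^bsub>?Q\<^esub> x = \<zero>\<^bsub>?Q\<^esub>" by (simp add: c add_Q zero_Q)
    then show "\<exists>y\<in>carrier ?Q. y \<oplus>\<^bsub>?Q\<^esub> x = \<zero>\<^bsub>?Q\<^esub>" by (auto simp: carrier_Q)
  qed (auto simp: carrier_Q zero_Q add_Q ac_simps)
  have mod: "Module.module class_ring ?Q"
    by (rule moduleI[OF Module.module.axioms(1)[OF M] ab])
      (auto simp: carrier_Q add_Q smult_Q distrib_left distrib_right mult.assoc)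
  show vs: "vectorspace class_ring ?Q"
    by (intro vectorspace.intro mod class_field.field_axioms)
  interpret Q: vectorspace class_ring ?Q by (rule vs)
  have lin: "Q.lincomb a {F 1} = F (a (F 1))" for a
    unfolding Q.lincomb_def by (simp add: carrier_Q smult_Q)
  have "Q.span {F 1} = carrier ?Q"
  proof -
    have "Q.span {F 1} = {F (a (F 1)) |a. True}"
      by (subst Q.finite_span) (auto simp: carrier_Q lin)
    also have "\<dots> = range F" by (auto intro: exI[of _ "\<lambda>_. _"])
    finally show ?thesis by (simp add: carrier_Q)
  qed
  moreover have "Q.lin_indpt {F 1}"
    by (rule Q.finite_lin_indpt2) (auto simp: carrier_Q lin zero_Q inj_F)
  ultimately have "Q.basis {F 1}" by (simp add: Q.basis_def carrier_Q)
  then show "Q.dim = 1" using Q.dim_basis[of "{F 1}"] by simp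
  show "Q.fin_dim" unfolding Q.fin_dim_def
    using \<open>Q.span {F 1} = carrier ?Q\<close> by (intro exI[of _ "{F 1}"]) (auto simp: carrier_Q)
qed

section \<open>Conformal modules\<close>

lemma lam_subst_const:
  fixes s :: "complex poly \<Rightarrow> 'm::ab_group_add \<Rightarrow> 'm"
  assumes "Modules.module s" and "degree P \<le> n"
  shows "lam_subst s P [:l:] = (\<Sum>j\<le>n. s [:l ^ j:] (coeff P j))"
proof -
  interpret Modules.module s by fact
  show ?thesis
    unfolding lam_subst_def poly_const_pow using assms(2)
    by (intro sum.mono_neutral_left) (auto simp: coeff_eq_0)
qed

lemma poly_eq_sum_le:
  fixes P :: "complex poly"
  assumes "degree P \<le> n"
  shows "poly P l = (\<Sum>j\<le>n. l ^ j * coeff P j)"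
  unfolding poly_altdef using assms
  by (intro sum.mono_neutral_cong_left) (auto simp: coeff_eq_0 mult.commute)

lemma module_vector_space:
  assumes "Modules.module s"
  shows "vector_space (\<lambda>c. s [:c::complex:])"
proof -
  interpret Modules.module s by fact
  show ?thesis
    by unfold_locales
      (simp_all add: scale_right_distrib scale_left_distrib [symmetric] one_pCons [symmetric] mult.commute)
qed

context conformal_module
begin

sublocale Alg: Modules.module "ascale R" by (rule module_R)
sublocale Mod: Modules.module "mscale V" by (rule module_V)

lemma action_add_left: "action V (a + b) l w = action V a l w + action V b l w"
  using action_linear_left by (simp add: Vector_Spaces.linear_iff)

lemma action_const_left: "action V (ascale R [:c:] a) l w = mscale V [:c:] (action V a l w)"
  using action_linear_left by (simp add: Vector_Spaces.linear_iff)

lemma action_add_right: "action V a l (w + w') = action V a l w + action V a l w'"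
  using action_linear_right by (simp add: Vector_Spaces.linear_iff)

lemma action_const_right: "action V a l (mscale V [:c:] w) = mscale V [:c:] (action V a l w)"
  using action_linear_right by (simp add: Vector_Spaces.linear_iff)

lemma action_zero_left: "action V 0 l w = 0"
  using action_add_left[of 0 0] by simp

lemma action_zero_right: "action V a l 0 = 0"
  using action_add_right[of a l 0 0] by simp

lemma pCons_split: "pCons c u = [:c:] + [:0, 1:] * (u :: complex poly)"
  by simp

lemma action_scale_left:
  "action V (ascale R u a) l w = mscale V [:poly u (- l):] (action V a l w)"
proof (induction u)
  case 0
  show ?case by (simp add: action_zero_left)
next
  case (pCons c u)
  have "ascale R (pCons c u) a = ascale R [:c:] a + ascale R [:0, 1:] (ascale R u a)"
    by (subst pCons_split) (simp only: Alg.scale_left_distrib Alg.scale_scale)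
  then have "action V (ascale R (pCons c u) a) l w =
      mscale V [:c:] (action V a l w) + mscale V [:- l:] (action V (ascale R u a) l w)"
    by (simp only: action_add_left action_const_left action_sesqui_left)
  also have "\<dots> = mscale V ([:c:] + [:- l:] * [:poly u (- l):]) (action V a l w)"
    by (simp only: pCons.IH Mod.scale_left_distrib Mod.scale_scale)
  finally show ?case by (simp add: mult.commute)
qed

lemma action_scale_right:
  "action V a l (mscale V u w) = mscale V (u \<circ>\<^sub>p [:l, 1:]) (action V a l w)"
proof (induction u)
  case 0
  show ?case by (simp add: action_zero_right)
next
  case (pCons c u)
  have "mscale V (pCons c u) w = mscale V [:c:] w + mscale V [:0, 1:] (mscale V u w)"
    by (subst pCons_split) (simp only: Mod.scale_left_distrib Mod.scale_scale)
  then have "action V a l (mscale V (pCons c u) w) =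
      mscale V [:c:] (action V a l w) + mscale V [:l, 1:] (action V a l (mscale V u w))"
    by (simp only: action_add_right action_const_right action_sesqui_right)
  also have "\<dots> = mscale V ([:c:] + [:l, 1:] * (u \<circ>\<^sub>p [:l, 1:])) (action V a l w)"
    by (simp only: pCons.IH Mod.scale_left_distrib Mod.scale_scale)
  finally show ?case by (simp only: pcompose_pCons)
qed

end

text \<open>
  The algebra acting on itself; this makes the two preceding rules for the action available for
  the bracket.
\<close>

definition adjoint_mod :: "'r::ab_group_add conf_alg \<Rightarrow> ('r, 'r) conf_mod" where
  "adjoint_mod R = \<lparr>mscale = ascale R, maction = abracket R\<rparr>"

lemma action_adjoint_mod: "action (adjoint_mod R) = bracket R"
  by (simp add: fun_eq_iff action_def bracket_def adjoint_mod_def)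

lemma conformal_module_adjoint:
  assumes "lie_conformal_algebra R"
  shows "conformal_module R (adjoint_mod R)"
proof -
  interpret lie_conformal_algebra R by fact
  show ?thesis
    by (intro conformal_module.intro conformal_module_axioms.intro;
        (unfold action_adjoint_mod)?; (unfold adjoint_mod_def conf_mod.select_convs)?)
      (rule lie_conformal_algebra_axioms module_R bracket_linear_left bracket_linear_right
        bracket_sesqui_left bracket_sesqui_right bracket_jacobi)+
qed

text \<open>
  Skew-symmetry substitutes \<open>- l - \<partial>\<close> for \<open>\<lambda>\<close> in the polynomial \<open>[a\<^sub>\<lambda> b]\<close>, so that its vanishing at all
  numbers has to be turned into its vanishing as a polynomial first.
\<close>

lemma (in lie_conformal_algebra) bracket_zero_swap:
  assumes "\<And>l. bracket R a l b = 0"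
  shows "bracket R b l a = 0"
proof -
  have "abracket R a b = 0"
    using assms
    by (intro lam_subst_eq_imp_eq[OF module_R])
      (simp add: bracket_def lam_subst_def[of _ 0] Modules.module.scale_zero_right[OF module_R])
  then show ?thesis
    by (subst bracket_skew) (simp add: lam_subst_def Modules.module.scale_zero_right[OF module_R])
qed

lemma mscale_one_dim_mod: "mscale (one_dim_mod \<eta>) u x = poly u \<eta> * x"
  by (simp add: one_dim_mod_def)

lemma module_one_dim_mod: "Modules.module (mscale (one_dim_mod \<eta>))"
  by unfold_locales (simp_all add: mscale_one_dim_mod algebra_simps)

lemma action_one_dim_mod: "action (one_dim_mod \<eta>) a l x = 0"
  by (simp add: action_def lam_subst_def one_dim_mod_def)

lemma conformal_module_one_dim:
  assumes "lie_conformal_algebra R"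
  shows "conformal_module R (one_dim_mod \<eta>)"
proof -
  interpret lie_conformal_algebra R by fact
  have vs: "vector_space (\<lambda>c. ascale R [:c:])" "vector_space (\<lambda>c. mscale (one_dim_mod \<eta>) [:c:])"
    by (intro module_vector_space module_R module_one_dim_mod)+
  show ?thesis
    by (intro conformal_module.intro conformal_module_axioms.intro)
      (use vs in \<open>simp_all add: lie_conformal_algebra_axioms module_one_dim_mod Vector_Spaces.linear_iff
        action_one_dim_mod, simp_all add: mscale_one_dim_mod\<close>)
qed

section \<open>Extensions by a one-dimensional module as cocycles\<close>

lemma coeff_pair_poly: "coeff (pair_poly X Y) j = (coeff X j, coeff Y j)"
  by (simp add: pair_poly_def coeff_map_poly zero_prod_def)

text \<open>
  Evaluation at \<open>\<lambda> = l\<close> only involves the scalars \<open>l\<^sup>j\<close>, on which \<open>d\<close> vanishes, and therefore acts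
  componentwise on \<open>\<complex>c\<^sub>\<eta> \<oplus> V\<close>.
\<close>

lemma action_twisted_mod:
  assumes V: "Modules.module (mscale V)" and d: "\<And>c w. fst z [:c:] w = 0"
  shows "action (twisted_mod (one_dim_mod \<eta>) V z) a l (x, w) =
    (poly (snd z a w) l, action V a l w)"
proof -
  let ?P = "pair_poly (snd z a w) (maction V a w)"
  let ?n = "degree ?P"
  have deg: "degree (snd z a w) \<le> ?n" "degree (maction V a w) \<le> ?n"
    by (intro degree_le allI impI; use coeff_eq_0[of ?P] in \<open>simp add: coeff_pair_poly zero_prod_def\<close>)+
  have "action (twisted_mod (one_dim_mod \<eta>) V z) a l (x, w) =
      (\<Sum>j\<le>?n. (l ^ j * coeff (snd z a w) j, mscale V [:l ^ j:] (coeff (maction V a w) j)))"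
    by (simp add: action_def lam_subst_def twisted_mod_def one_dim_mod_def coeff_pair_poly d poly_const_pow)
  also have "\<dots> = (\<Sum>j\<le>?n. l ^ j * coeff (snd z a w) j,
      \<Sum>j\<le>?n. mscale V [:l ^ j:] (coeff (maction V a w) j))"
    by (simp add: prod_eq_iff fst_sum snd_sum)
  also have "\<dots> = (poly (snd z a w) l, action V a l w)"
    unfolding action_def using deg
    by (simp add: lam_subst_const[OF V] poly_eq_sum_le)
  finally show ?thesis .
qed

lemma mscale_twisted_mod:
  "mscale (twisted_mod (one_dim_mod \<eta>) V z) u (x, w) = (poly u \<eta> * x + fst z u w, mscale V u w)"
  by (simp add: twisted_mod_def one_dim_mod_def)

lemma direct_sum_eq_twisted_zero:
  "direct_sum_mod (one_dim_mod \<eta>) V = twisted_mod (one_dim_mod \<eta>) V (\<lambda>_ _. 0, \<lambda>_ _. 0)"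
  by (simp add: direct_sum_mod_def twisted_mod_def)

text \<open>
  The module axioms of the twisted module, each reduced to its \<open>c\<^sub>\<eta>\<close>-component on the elements
  \<open>(0, w)\<close>. The component in \<open>V\<close> holds because \<open>V\<close> is a module, and \<open>R\<close> acts by zero on \<open>c\<^sub>\<eta>\<close>. All the
  equations are linear in \<open>(d, \<psi>)\<close>.
\<close>

locale ext_cocycle = conformal_module R V
  for R :: "'r::ab_group_add conf_alg" and V :: "('r, 'v::ab_group_add) conf_mod" +
  fixes \<eta> :: complex and d :: "complex poly \<Rightarrow> 'v \<Rightarrow> complex" and \<psi> :: "'r \<Rightarrow> 'v \<Rightarrow> complex poly"
  assumes d_const: "d [:c:] w = 0"
    and d_add_right: "d u (w + w') = d u w + d u w'"
    and d_add_left: "d (u + u') w = d u w + d u' w"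
    and d_mult: "d (u * u') w = poly u \<eta> * d u' w + d u (mscale V u' w)"
    and psi_add_left: "poly (\<psi> (a + b) w) l = poly (\<psi> a w) l + poly (\<psi> b w) l"
    and psi_const_left: "poly (\<psi> (ascale R [:c:] a) w) l = c * poly (\<psi> a w) l"
    and psi_add_right: "poly (\<psi> a (w + w')) l = poly (\<psi> a w) l + poly (\<psi> a w') l"
    and psi_const_right: "poly (\<psi> a (mscale V [:c:] w)) l = c * poly (\<psi> a w) l"
    and psi_sesqui_left: "poly (\<psi> (ascale R [:0, 1:] a) w) l = - l * poly (\<psi> a w) l"
    and psi_sesqui_right:
      "poly (\<psi> a (mscale V [:0, 1:] w)) l = (l + \<eta>) * poly (\<psi> a w) l + d [:l, 1:] (action V a l w)"
    and psi_jacobi: "poly (\<psi> a (action V b m w)) l =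
      poly (\<psi> (bracket R a l b) w) (l + m) + poly (\<psi> b (action V a l w)) m"
begin

lemma d_zero_right: "d u 0 = 0"
  using d_add_right[of u 0 0] by simp

lemma psi_zero_right: "\<psi> a 0 = 0"
  by (rule poly_ext) (use psi_add_right[of a 0 0] in simp)

lemma extension_twisted_mod:
  "extension R (one_dim_mod \<eta>) V (twisted_mod (one_dim_mod \<eta>) V (d, \<psi>)) (\<lambda>x. (x, 0)) snd"
proof -
  let ?T = "twisted_mod (one_dim_mod \<eta>) V (d, \<psi>)"
  have sc: "mscale ?T u (x, w) = (poly u \<eta> * x + d u w, mscale V u w)" for u x w
    by (simp add: mscale_twisted_mod)
  have act: "action ?T a l (x, w) = (poly (\<psi> a w) l, action V a l w)" for a l x w
    by (simp add: action_twisted_mod module_V d_const)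
  have mod: "Modules.module (mscale ?T)"
  proof
    fix u u' and x y :: "complex \<times> 'v"
    obtain x1 x2 y1 y2 where xy: "x = (x1, x2)" "y = (y1, y2)" by (cases x; cases y)
    show "mscale ?T u (x + y) = mscale ?T u x + mscale ?T u y"
      by (simp add: xy sc Mod.scale_right_distrib d_add_right algebra_simps)
    show "mscale ?T (u + u') x = mscale ?T u x + mscale ?T u' x"
      by (simp add: xy sc Mod.scale_left_distrib d_add_left algebra_simps)
    show "mscale ?T u (mscale ?T u' x) = mscale ?T (u * u') x"
      by (simp add: xy sc d_mult distrib_left mult.assoc)
    show "mscale ?T 1 x = x"
      using d_const[of 1] by (simp add: xy sc one_pCons[symmetric])
  qed
  have vs: "vector_space (\<lambda>c. ascale R [:c:])" "vector_space (\<lambda>c. mscale ?T [:c:])"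
    by (intro module_vector_space module_R mod)+
  have "conformal_module R ?T"
  proof (intro conformal_module.intro conformal_module_axioms.intro)
    show "lie_conformal_algebra R" ..
    show "Modules.module (mscale ?T)" by (rule mod)
    fix a b l m and x :: "complex \<times> 'v"
    obtain x1 x2 where x: "x = (x1, x2)" by (cases x)
    show "Vector_Spaces.linear (\<lambda>c. ascale R [:c:]) (\<lambda>c. mscale ?T [:c:]) (\<lambda>a. action ?T a l x)"
      by (simp add: Vector_Spaces.linear_iff vs x act sc d_const psi_add_left psi_const_left
          action_add_left action_const_left)
    show "Vector_Spaces.linear (\<lambda>c. mscale ?T [:c:]) (\<lambda>c. mscale ?T [:c:]) (action ?T a l)"
      by (simp add: Vector_Spaces.linear_iff vs split_paired_all act sc d_const psi_add_right
          psi_const_right action_add_right action_const_right)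
    show "action ?T (ascale R [:0, 1:] a) l x = mscale ?T [:- l:] (action ?T a l x)"
      by (simp add: x act sc d_const psi_sesqui_left action_sesqui_left)
    show "action ?T a l (mscale ?T [:0, 1:] x) = mscale ?T [:l, 1:] (action ?T a l x)"
      by (simp add: x act sc psi_sesqui_right action_sesqui_right)
    show "action ?T a l (action ?T b m x) =
        action ?T (bracket R a l b) (l + m) x + action ?T b m (action ?T a l x)"
      by (simp add: x act psi_jacobi[of a b m] action_jacobi[of a l b m])
  qed
  then show ?thesis
    by (auto simp: extension_def conf_hom_def conformal_module_one_dim
        lie_conformal_algebra_axioms conformal_module_axioms module_hom_iff mod
        module_one_dim_mod module_V sc act mscale_one_dim_mod action_one_dim_mod
        action_zero_right psi_zero_right d_zero_right zero_prod_def inj_on_def surj_def)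
qed

end

lemma mem_ext_cocycles_iff:
  assumes "conformal_module R V"
  shows "z \<in> ext_cocycles R V (one_dim_mod \<eta>) \<longleftrightarrow> ext_cocycle R V \<eta> (fst z) (snd z)"
proof
  interpret V: conformal_module R V by fact
  let ?T = "twisted_mod (one_dim_mod \<eta>) V z"
  note sc = mscale_twisted_mod
  assume "z \<in> ext_cocycles R V (one_dim_mod \<eta>)"
  then interpret T: conformal_module R ?T
    by (simp add: ext_cocycles_def extension_def)
  have d0: "fst z [:c:] w = 0" for c w
    using \<open>z \<in> _\<close> by (simp add: ext_cocycles_def)
  have act: "action ?T a l (x, w) = (poly (snd z a w) l, action V a l w)" for a l x w
    using V.module_V d0 by (rule action_twisted_mod)
  show "ext_cocycle R V \<eta> (fst z) (snd z)"
  proof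
    fix u u' w w' a b l m c
    show "fst z [:c:] w = 0" by (rule d0)
    show "fst z u (w + w') = fst z u w + fst z u w'"
      using T.Mod.scale_right_distrib[of u "(0, w)" "(0, w')"] by (simp add: sc)
    show "fst z (u + u') w = fst z u w + fst z u' w"
      using T.Mod.scale_left_distrib[of u u' "(0, w)"] by (simp add: sc)
    show "fst z (u * u') w = poly u \<eta> * fst z u' w + fst z u (mscale V u' w)"
      using T.Mod.scale_scale[of u u' "(0, w)"] by (simp add: sc)
    show "poly (snd z (a + b) w) l = poly (snd z a w) l + poly (snd z b w) l"
      using T.action_add_left[of a b l "(0, w)"] by (simp add: act)
    show "poly (snd z (ascale R [:c:] a) w) l = c * poly (snd z a w) l"
      using T.action_const_left[of c a l "(0, w)"] by (simp add: act sc d0)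
    show "poly (snd z a (w + w')) l = poly (snd z a w) l + poly (snd z a w') l"
      using T.action_add_right[of a l "(0, w)" "(0, w')"] by (simp add: act)
    show "poly (snd z a (mscale V [:c:] w)) l = c * poly (snd z a w) l"
      using T.action_const_right[of a l c "(0, w)"] by (simp add: act sc d0)
    show "poly (snd z (ascale R [:0, 1:] a) w) l = - l * poly (snd z a w) l"
      using T.action_sesqui_left[of a l "(0, w)"] by (simp add: act sc d0)
    show "poly (snd z a (mscale V [:0, 1:] w)) l =
        (l + \<eta>) * poly (snd z a w) l + fst z [:l, 1:] (action V a l w)"
      using T.action_sesqui_right[of a l "(0, w)"] by (simp add: act sc)
    show "poly (snd z a (action V b m w)) l =
        poly (snd z (bracket R a l b) w) (l + m) + poly (snd z b (action V a l w)) m"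
      using T.action_jacobi[of a l b m "(0, w)"] by (simp add: act)
  qed
next
  assume "ext_cocycle R V \<eta> (fst z) (snd z)"
  then interpret ext_cocycle R V \<eta> "fst z" "snd z" .
  show "z \<in> ext_cocycles R V (one_dim_mod \<eta>)"
    using extension_twisted_mod d_const by (simp add: ext_cocycles_def)
qed

lemma ext_cocycle_linear_combination:
  assumes "ext_cocycle R V \<eta> d \<psi>" and "ext_cocycle R V \<eta> d' \<psi>'"
  shows "ext_cocycle R V \<eta> (\<lambda>u w. c * d u w + d' u w) (\<lambda>a w. Polynomial.smult c (\<psi> a w) + \<psi>' a w)"
proof -
  interpret X: ext_cocycle R V \<eta> d \<psi> by fact
  interpret Y: ext_cocycle R V \<eta> d' \<psi>' by fact
  show ?thesis
  proof
    fix u u' w w' a b l m and k :: complex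
    show "c * d [:k:] w + d' [:k:] w = 0" by (simp add: X.d_const Y.d_const)
    show "c * d u (w + w') + d' u (w + w') = (c * d u w + d' u w) + (c * d u w' + d' u w')"
      by (simp add: X.d_add_right Y.d_add_right algebra_simps)
    show "c * d (u + u') w + d' (u + u') w = (c * d u w + d' u w) + (c * d u' w + d' u' w)"
      by (simp add: X.d_add_left Y.d_add_left algebra_simps)
    show "c * d (u * u') w + d' (u * u') w =
        poly u \<eta> * (c * d u' w + d' u' w) + (c * d u (mscale V u' w) + d' u (mscale V u' w))"
      by (simp only: X.d_mult Y.d_mult) (simp add: algebra_simps)
    let ?\<psi> = "\<lambda>a w. Polynomial.smult c (\<psi> a w) + \<psi>' a w"
    show "poly (?\<psi> (a + b) w) l = poly (?\<psi> a w) l + poly (?\<psi> b w) l"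
      by (simp add: X.psi_add_left Y.psi_add_left algebra_simps)
    show "poly (?\<psi> (ascale R [:k:] a) w) l = k * poly (?\<psi> a w) l"
      by (simp add: X.psi_const_left Y.psi_const_left algebra_simps)
    show "poly (?\<psi> a (w + w')) l = poly (?\<psi> a w) l + poly (?\<psi> a w') l"
      by (simp add: X.psi_add_right Y.psi_add_right algebra_simps)
    show "poly (?\<psi> a (mscale V [:k:] w)) l = k * poly (?\<psi> a w) l"
      by (simp add: X.psi_const_right Y.psi_const_right algebra_simps)
    show "poly (?\<psi> (ascale R [:0, 1:] a) w) l = - l * poly (?\<psi> a w) l"
      by (simp add: X.psi_sesqui_left Y.psi_sesqui_left algebra_simps)
    show "poly (?\<psi> a (mscale V [:0, 1:] w)) l = (l + \<eta>) * poly (?\<psi> a w) l +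
        (c * d [:l, 1:] (action V a l w) + d' [:l, 1:] (action V a l w))"
      by (simp add: X.psi_sesqui_right Y.psi_sesqui_right algebra_simps)
    show "poly (?\<psi> a (action V b m w)) l =
        poly (?\<psi> (bracket R a l b) w) (l + m) + poly (?\<psi> b (action V a l w)) m"
      by (simp add: X.psi_jacobi[of a b m w l] Y.psi_jacobi[of a b m w l] algebra_simps)
  qed
qed

lemma ext_cocycle_zero:
  assumes "conformal_module R V"
  shows "ext_cocycle R V \<eta> (\<lambda>_ _. 0) (\<lambda>_ _. 0)"
proof -
  interpret conformal_module R V by fact
  show ?thesis by unfold_locales simp_all
qed

lemma module_cocycle_space:
  assumes V: "conformal_module R V"
  shows "Module.module class_ring (cocycle_space R V (one_dim_mod \<eta>))"
proof -
  let ?M = "cocycle_space R V (one_dim_mod \<eta>)"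
  have smult: "c \<odot>\<^bsub>?M\<^esub> z = (\<lambda>u w. c * fst z u w, \<lambda>a w. Polynomial.smult c (snd z a w))" for c z
    by (simp add: cocycle_space_def mscale_one_dim_mod fun_eq_iff poly_eq_iff coeff_map_poly)
  have add: "z \<oplus>\<^bsub>?M\<^esub> z' = (\<lambda>u w. fst z u w + fst z' u w, \<lambda>a w. snd z a w + snd z' a w)" for z z'
    by (simp add: cocycle_space_def)
  have zero: "\<zero>\<^bsub>?M\<^esub> = (\<lambda>u w. 0, \<lambda>a w. 0)" by (simp add: cocycle_space_def)
  have carrier: "z \<in> carrier ?M \<longleftrightarrow> ext_cocycle R V \<eta> (fst z) (snd z)" for z
    by (simp add: cocycle_space_def mem_ext_cocycles_iff[OF V])
  have add_closed: "z \<oplus>\<^bsub>?M\<^esub> z' \<in> carrier ?M" if "z \<in> carrier ?M" "z' \<in> carrier ?M" for z z'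
    using ext_cocycle_linear_combination[of R V \<eta> "fst z" "snd z" "fst z'" "snd z'" 1] that
    by (simp add: add carrier)
  have smult_closed: "c \<odot>\<^bsub>?M\<^esub> z \<in> carrier ?M" if "z \<in> carrier ?M" for c z
    using ext_cocycle_linear_combination[OF _ ext_cocycle_zero[OF V], of \<eta> "fst z" "snd z" c] that
    by (simp add: smult carrier)
  have "abelian_group ?M"
  proof (rule abelian_groupI)
    show "\<zero>\<^bsub>?M\<^esub> \<in> carrier ?M" using ext_cocycle_zero[OF V] by (simp add: zero carrier)
    fix z assume z: "z \<in> carrier ?M"
    have "(-1) \<odot>\<^bsub>?M\<^esub> z \<oplus>\<^bsub>?M\<^esub> z = \<zero>\<^bsub>?M\<^esub>" by (simp add: add smult zero)
    then show "\<exists>y\<in>carrier ?M. y \<oplus>\<^bsub>?M\<^esub> z = \<zero>\<^bsub>?M\<^esub>" using smult_closed[OF z] by blast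
  qed (simp_all add: add_closed, simp_all add: add zero ac_simps)
  then show ?thesis
    by (rule moduleI[OF class_cring.cring_axioms])
      (simp_all add: smult_closed, simp_all add: add smult distrib_left distrib_right mult.assoc smult_add_left smult_add_right)
qed

section \<open>Extensions of the rank one modules of the algebra of Type I\<close>

locale type_I_rank_one =
  fixes R :: "'r::ab_group_add conf_alg" and A B :: 'r
    and V :: "('r, 'v::ab_group_add) conf_mod" and v :: 'v
    and \<delta>\<^sub>1 \<delta>\<^sub>2 \<alpha> \<beta> :: complex and \<phi> :: "complex poly"
  assumes algebra: "type_I_algebra R A B"
    and rank_one: "type_I_module R A B V v \<delta>\<^sub>1 \<delta>\<^sub>2 \<alpha> \<beta> \<phi>"
begin

sublocale V: conformal_module R V
  using rank_one by (simp add: type_I_module_def)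

lemma A_neq_B: "A \<noteq> B"
  and independent_AB: "\<not> V.Alg.dependent {A, B}"
  and span_AB: "V.Alg.span {A, B} = UNIV"
  and bracket_AA: "bracket R A l A = ascale R [:2 * l, 1:] A"
  and bracket_AB: "bracket R A l B = 0"
  and bracket_BB: "bracket R B l B = 0"
  using algebra by (simp_all add: type_I_algebra_def)

lemma bracket_BA: "bracket R B l A = 0"
  using bracket_AB by (rule V.bracket_zero_swap)

lemma independent_v: "\<not> V.Mod.dependent {v}"
  and span_v: "V.Mod.span {v} = UNIV"
  and deltas: "\<delta>\<^sub>1 = 1 \<and> \<delta>\<^sub>2 = 0 \<or> \<delta>\<^sub>1 = 0 \<and> \<delta>\<^sub>2 = 1"
  and alpha: "\<alpha> \<noteq> 0" and phi: "\<phi> \<noteq> 0"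
  and action_A: "action V A l v = mscale V [:\<delta>\<^sub>1 * (\<alpha> * l + \<beta>), \<delta>\<^sub>1:] v"
  and action_B: "action V B l v = mscale V [:\<delta>\<^sub>2 * poly \<phi> l:] v"
  using rank_one by (auto simp: type_I_module_def)

definition coord_A :: "'r \<Rightarrow> complex poly" where
  "coord_A a = V.Alg.representation {A, B} a A"

definition coord_B :: "'r \<Rightarrow> complex poly" where
  "coord_B a = V.Alg.representation {A, B} a B"

definition coord_v :: "'v \<Rightarrow> complex poly" where
  "coord_v w = V.Mod.representation {v} w v"

lemma coord_AB: "a = ascale R (coord_A a) A + ascale R (coord_B a) B"
  using V.Alg.sum_representation_eq[OF independent_AB, of a "{A, B}"] A_neq_B span_AB
  by (simp add: coord_A_def coord_B_def)

lemma coord_v: "mscale V (coord_v w) v = w"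
  using V.Mod.sum_representation_eq[OF independent_v, of w "{v}"] span_v
  by (simp add: coord_v_def)

lemma coord_A_simps [simp]:
  "coord_A (a + b) = coord_A a + coord_A b"
  "coord_A (ascale R u a) = u * coord_A a"
  "coord_A A = 1" "coord_A B = 0" "coord_A 0 = 0"
  using span_AB A_neq_B
  by (simp_all add: coord_A_def V.Alg.representation_add[OF independent_AB]
      V.Alg.representation_scale[OF independent_AB] V.Alg.representation_basis[OF independent_AB]
      V.Alg.representation_zero)

lemma coord_B_simps [simp]: "coord_B A = 0" "coord_B B = 1"
  using A_neq_B by (simp_all add: coord_B_def V.Alg.representation_basis[OF independent_AB])

lemma coord_v_simps [simp]:
  "coord_v (w + w') = coord_v w + coord_v w'"
  "coord_v (mscale V u w) = u * coord_v w"
  "coord_v v = 1"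
  using span_v
  by (simp_all add: coord_v_def V.Mod.representation_add[OF independent_v]
      V.Mod.representation_scale[OF independent_v] V.Mod.representation_basis[OF independent_v])

lemma mscale_v_inject: "mscale V q v = mscale V q' v \<longleftrightarrow> q = q'"
proof
  assume "mscale V q v = mscale V q' v"
  then have "coord_v (mscale V q v) = coord_v (mscale V q' v)" by simp
  then show "q = q'" by simp
qed simp

text \<open>
  The data of a standard form for a chosen preimage \<open>v'\<close> of \<open>v\<close>. Keeping \<open>v'\<close> explicit allows one to
  change it.
\<close>

definition lift ::
  "('r, 'e::ab_group_add) conf_mod \<Rightarrow> (complex \<Rightarrow> 'e) \<Rightarrow> ('e \<Rightarrow> 'v) \<Rightarrow> 'e \<Rightarrow>
    complex poly \<Rightarrow> complex poly \<Rightarrow> bool" where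
  "lift E i p v' f g \<longleftrightarrow> p v' = v \<and>
    (\<forall>l. action E A l v' = mscale E [:\<delta>\<^sub>1 * (\<alpha> * l + \<beta>), \<delta>\<^sub>1:] v' + i (poly f l)) \<and>
    (\<forall>l. action E B l v' = mscale E [:\<delta>\<^sub>2 * poly \<phi> l:] v' + i (poly g l))"

end

locale rank_one_extension = type_I_rank_one R A B V v \<delta>\<^sub>1 \<delta>\<^sub>2 \<alpha> \<beta> \<phi>
  for R :: "'r::ab_group_add conf_alg" and A B :: 'r
    and V :: "('r, 'v::ab_group_add) conf_mod" and v :: 'v
    and \<delta>\<^sub>1 \<delta>\<^sub>2 \<alpha> \<beta> :: complex and \<phi> :: "complex poly" +
  fixes \<eta> :: complex and E :: "('r, 'e::ab_group_add) conf_mod"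
    and i :: "complex \<Rightarrow> 'e" and p :: "'e \<Rightarrow> 'v"
  assumes ext: "extension R (one_dim_mod \<eta>) V E i p"
begin

sublocale E: conformal_module R E
  using ext by (simp add: extension_def)

lemma i_add: "i (x + y) = i x + i y"
  and i_scale: "mscale E u (i x) = i (poly u \<eta> * x)"
  and p_add: "p (e + e') = p e + p e'"
  and p_scale: "p (mscale E u e) = mscale V u (p e)"
  and p_action: "p (action E a l e) = action V a l (p e)"
  and i_eq_iff: "i x = i y \<longleftrightarrow> x = y"
  and p_i: "p (i x) = 0"
  and p_eq_0: "p e = 0 \<Longrightarrow> \<exists>x. e = i x"
  and p_surj: "\<exists>e. p e = w"
  using ext by (auto simp: extension_def conf_hom_def module_hom_iff mscale_one_dim_mod inj_eq) 
    (metis surjD)+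

lemma i_0 [simp]: "i 0 = 0"
  using i_add[of 0 0] by simp

lemma p_diff: "p (e - e') = p e - p e'"
  using p_add[of "e - e'" e'] by simp

lemma action_i: "action E a l (i x) = 0"
proof -
  have "action E a l (i x) = i (action (one_dim_mod \<eta>) a l x)"
    using ext by (simp add: extension_def conf_hom_def)
  then show ?thesis by (simp add: action_one_dim_mod)
qed

lemma decomposition_inject:
  assumes "p v' = v"
  shows "i x + mscale E q v' = i y + mscale E q' v' \<longleftrightarrow> x = y \<and> q = q'"
proof
  assume eq: "i x + mscale E q v' = i y + mscale E q' v'"
  then have "p (i x + mscale E q v') = p (i y + mscale E q' v')" by simp
  then have "q = q'" by (simp add: p_add p_i p_scale assms mscale_v_inject)
  with eq show "x = y \<and> q = q'" by (simp add: i_eq_iff)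
qed simp

lemma decomposition:
  assumes "p v' = v"
  obtains x q where "e = i x + mscale E q v'"
proof -
  have "p (e - mscale E (coord_v (p e)) v') = 0"
    by (simp add: p_diff p_scale assms coord_v)
  then obtain x where "e - mscale E (coord_v (p e)) v' = i x" using p_eq_0 by blast
  then show ?thesis by (intro that) (simp add: algebra_simps)
qed

text \<open>
  Decomposing each coefficient of the polynomial \<open>a\<^sub>\<lambda> v'\<close> along \<open>E = \<complex>c\<^sub>\<eta> \<oplus> \<complex>[\<partial>]v'\<close> shows that its
  \<open>c\<^sub>\<eta>\<close>-component depends polynomially on \<open>\<lambda>\<close>; the other component is found by projecting to \<open>V\<close>.
\<close>

lemma polynomial_lift:
  assumes v': "p v' = v" and V: "\<And>l. action V a l v = mscale V (U l) v"
  obtains f where "\<And>l. action E a l v' = mscale E (U l) v' + i (poly f l)"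
proof -
  let ?P = "maction E a v'" and ?n = "degree (maction E a v')"
  have "\<forall>j. \<exists>x q. coeff ?P j = i x + mscale E q v'"
    using decomposition[OF v'] by metis
  then obtain x q where xq: "\<And>j. coeff ?P j = i (x j) + mscale E (q j) v'" by metis
  define f where "f = (\<Sum>j\<le>?n. monom (x j) j)"
  have sum_i: "(\<Sum>j\<in>J. i (y j)) = i (\<Sum>j\<in>J. y j)" for J :: "nat set" and y
    by (induction J rule: infinite_finite_induct) (simp_all add: i_add)
  have act: "action E a l v' = mscale E (\<Sum>j\<le>?n. [:l ^ j:] * q j) v' + i (poly f l)" for l
  proof -
    have "action E a l v' = (\<Sum>j\<le>?n. mscale E [:l ^ j:] (i (x j) + mscale E (q j) v'))"
      unfolding action_def by (simp add: lam_subst_const[OF E.module_V order_refl] xq)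
    also have "\<dots> = (\<Sum>j\<le>?n. i (l ^ j * x j)) + (\<Sum>j\<le>?n. mscale E ([:l ^ j:] * q j) v')"
      by (simp only: E.Mod.scale_right_distrib i_scale E.Mod.scale_scale sum.distrib) simp
    also have "(\<Sum>j\<le>?n. i (l ^ j * x j)) = i (poly f l)"
      by (simp add: sum_i f_def poly_sum poly_monom mult.commute)
    also have "(\<Sum>j\<le>?n. mscale E ([:l ^ j:] * q j) v') = mscale E (\<Sum>j\<le>?n. [:l ^ j:] * q j) v'"
      by (simp only: E.Mod.scale_sum_left)
    finally show ?thesis by (simp add: add.commute)
  qed
  have "(\<Sum>j\<le>?n. [:l ^ j:] * q j) = U l" for l
  proof -
    have "p (action E a l v') = mscale V (\<Sum>j\<le>?n. [:l ^ j:] * q j) v"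
      by (simp only: act p_add p_scale p_i v' add_0_right)
    then show ?thesis by (simp only: p_action v' V mscale_v_inject)
  qed
  with act show ?thesis by (intro that) simp
qed

lemma lift_exists:
  assumes "p v' = v"
  shows "\<exists>f g. lift E i p v' f g"
proof -
  obtain f where "\<And>l. action E A l v' = mscale E [:\<delta>\<^sub>1 * (\<alpha> * l + \<beta>), \<delta>\<^sub>1:] v' + i (poly f l)"
    using polynomial_lift[OF assms action_A] by blast
  moreover obtain g where "\<And>l. action E B l v' = mscale E [:\<delta>\<^sub>2 * poly \<phi> l:] v' + i (poly g l)"
    using polynomial_lift[OF assms action_B] by blast
  ultimately show ?thesis using assms by (auto simp: lift_def)
qed

lemma standard_form_lift:
  assumes "lift E i p v' f g"
  shows "standard_form A B v \<delta>\<^sub>1 \<delta>\<^sub>2 \<alpha> \<beta> \<phi> \<eta> E i p f g"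
proof -
  have v': "p v' = v" using assms by (simp add: lift_def)
  have const: "mscale E [:x:] (i 1) = i x" for x by (simp add: i_scale)
  have "bij (\<lambda>(x, q). mscale E [:x:] (i 1) + mscale E q v')"
    unfolding bij_def
  proof
    show "inj (\<lambda>(x, q). mscale E [:x:] (i 1) + mscale E q v')"
      by (auto simp: inj_def const decomposition_inject[OF v'])
    show "surj (\<lambda>(x, q). mscale E [:x:] (i 1) + mscale E q v')"
      unfolding surj_def
    proof
      fix e
      obtain x q where "e = i x + mscale E q v'" using decomposition[OF v'] .
      then have "e = (\<lambda>(x, q). mscale E [:x:] (i 1) + mscale E q v') (x, q)" by (simp add: const)
      then show "\<exists>z. e = (\<lambda>(x, q). mscale E [:x:] (i 1) + mscale E q v') z" by blast
    qed
  qed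
  then show ?thesis
    using assms unfolding standard_form_def
    by (intro exI[of _ "i 1"] exI[of _ v'])
      (simp add: lift_def const action_i i_scale)
qed

text \<open>
  The right hand side mentions \<open>E\<close> only through \<open>v'\<close>, \<open>f\<close> and \<open>g\<close>. The \<open>c\<^sub>\<eta>\<close>-component carries
  \<open>q(\<eta> + \<lambda>)\<close>, since moving \<open>q(\<partial>)\<close> across the action shifts \<open>\<partial>\<close> by \<open>\<lambda>\<close> and \<open>\<partial>\<close> acts on \<open>c\<^sub>\<eta>\<close> as \<open>\<eta>\<close>.
\<close>

lemma action_lift:
  assumes "lift E i p v' f g"
  shows "action E a l (i x + mscale E q v') =
    i (poly q (\<eta> + l) * (poly (coord_A a) (- l) * poly f l + poly (coord_B a) (- l) * poly g l)) +
    mscale E ((q \<circ>\<^sub>p [:l, 1:]) * ([:poly (coord_A a) (- l):] * [:\<delta>\<^sub>1 * (\<alpha> * l + \<beta>), \<delta>\<^sub>1:] +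
      [:poly (coord_B a) (- l):] * [:\<delta>\<^sub>2 * poly \<phi> l:])) v'"
proof -
  have actA: "action E A l v' = mscale E [:\<delta>\<^sub>1 * (\<alpha> * l + \<beta>), \<delta>\<^sub>1:] v' + i (poly f l)"
    and actB: "action E B l v' = mscale E [:\<delta>\<^sub>2 * poly \<phi> l:] v' + i (poly g l)"
    using assms by (simp_all add: lift_def)
  have "action E a l (i x + mscale E q v') = mscale E (q \<circ>\<^sub>p [:l, 1:]) (action E a l v')"
    by (simp only: E.action_add_right action_i E.action_scale_right add_0_left)
  also have "action E a l v' = action E (ascale R (coord_A a) A + ascale R (coord_B a) B) l v'"
    by (simp only: coord_AB[symmetric])
  also have "mscale E (q \<circ>\<^sub>p [:l, 1:]) \<dots> = mscale E (q \<circ>\<^sub>p [:l, 1:])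
      (mscale E [:poly (coord_A a) (- l):] (mscale E [:\<delta>\<^sub>1 * (\<alpha> * l + \<beta>), \<delta>\<^sub>1:] v' + i (poly f l)) +
       mscale E [:poly (coord_B a) (- l):] (mscale E [:\<delta>\<^sub>2 * poly \<phi> l:] v' + i (poly g l)))"
    by (simp only: E.action_add_left E.action_scale_left actA actB)
  also have "\<dots> = mscale E ((q \<circ>\<^sub>p [:l, 1:]) * ([:poly (coord_A a) (- l):] * [:\<delta>\<^sub>1 * (\<alpha> * l + \<beta>), \<delta>\<^sub>1:])) v' +
       mscale E ((q \<circ>\<^sub>p [:l, 1:]) * ([:poly (coord_B a) (- l):] * [:\<delta>\<^sub>2 * poly \<phi> l:])) v' +
      (i (poly (q \<circ>\<^sub>p [:l, 1:]) \<eta> * (poly (coord_A a) (- l) * poly f l)) +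
       i (poly (q \<circ>\<^sub>p [:l, 1:]) \<eta> * (poly (coord_B a) (- l) * poly g l)))"
    by (simp only: E.Mod.scale_right_distrib E.Mod.scale_scale i_scale) (simp add: ac_simps)
  also have "\<dots> = i (poly (q \<circ>\<^sub>p [:l, 1:]) \<eta> * (poly (coord_A a) (- l) * poly f l) +
      poly (q \<circ>\<^sub>p [:l, 1:]) \<eta> * (poly (coord_B a) (- l) * poly g l)) +
    mscale E ((q \<circ>\<^sub>p [:l, 1:]) * ([:poly (coord_A a) (- l):] * [:\<delta>\<^sub>1 * (\<alpha> * l + \<beta>), \<delta>\<^sub>1:] +
      [:poly (coord_B a) (- l):] * [:\<delta>\<^sub>2 * poly \<phi> l:])) v'"
    by (simp only: distrib_left E.Mod.scale_left_distrib i_add add.commute)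
  finally show ?thesis by (simp only: poly_pcompose) (simp add: algebra_simps)
qed

text \<open>
  The left hand sides do not change, since \<open>R\<close> kills \<open>c\<^sub>\<eta>\<close>. On the right, \<open>\<delta>\<^sub>1(\<partial> + \<alpha>\<lambda> + \<beta>)\<close> and
  \<open>\<delta>\<^sub>2\<phi>(\<lambda>)\<close> applied to the new summand \<open>k c\<^sub>\<eta>\<close> have to be compensated.
\<close>

lemma lift_translate:
  assumes "lift E i p v' f g"
  shows "lift E i p (v' + i k)
    (f - Polynomial.smult (k * \<delta>\<^sub>1) [:\<beta> + \<eta>, \<alpha>:]) (g - Polynomial.smult (k * \<delta>\<^sub>2) \<phi>)"
proof -
  have "mscale E [:\<delta>\<^sub>1 * (\<alpha> * l + \<beta>), \<delta>\<^sub>1:] v' + i (poly f l) =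
      mscale E [:\<delta>\<^sub>1 * (\<alpha> * l + \<beta>), \<delta>\<^sub>1:] v' + i ((\<delta>\<^sub>1 * (\<alpha> * l + \<beta>) + \<eta> * \<delta>\<^sub>1) * k) +
      i (poly f l - k * \<delta>\<^sub>1 * (\<beta> + \<eta> + l * \<alpha>))" for l
    by (simp add: add.assoc i_add[symmetric] algebra_simps)
  moreover have "mscale E [:\<delta>\<^sub>2 * poly \<phi> l:] v' + i (poly g l) =
      mscale E [:\<delta>\<^sub>2 * poly \<phi> l:] v' + i (\<delta>\<^sub>2 * poly \<phi> l * k) + i (poly g l - k * \<delta>\<^sub>2 * poly \<phi> l)" for l
    by (simp add: add.assoc i_add[symmetric] algebra_simps)
  ultimately show ?thesis
    using assms
    by (simp add: lift_def p_add p_i E.action_add_right action_i E.Mod.scale_right_distrib i_scale)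
      (simp add: algebra_simps)
qed

section \<open>The cocycle equations and the normal form\<close>

text \<open>
  The projection of \<open>E = \<complex>c\<^sub>\<eta> \<oplus> \<complex>[\<partial>]v'\<close> to the first summand, with \<open>c\<^sub>\<eta>\<close> identified with 1.
\<close>

definition c_part :: "'e \<Rightarrow> 'e \<Rightarrow> complex" where
  "c_part v' e = inv_into UNIV i (e - mscale E (coord_v (p e)) v')"

lemma c_part_decomposition:
  assumes "p v' = v"
  shows "c_part v' (i x + mscale E q v') = x"
  by (simp add: c_part_def p_add p_i p_scale assms inv_f_f inj_def i_eq_iff)

lemma decomposition_c_part:
  assumes "p v' = v"
  shows "e = i (c_part v' e) + mscale E (coord_v (p e)) v'"
proof -
  obtain x q where e: "e = i x + mscale E q v'" using decomposition[OF assms] .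
  then show ?thesis by (simp add: c_part_decomposition assms p_add p_i p_scale)
qed

lemma c_part_add:
  assumes "p v' = v"
  shows "c_part v' (e + e') = c_part v' e + c_part v' e'"
proof -
  have "e + e' = i (c_part v' e + c_part v' e') + mscale E (coord_v (p e) + coord_v (p e')) v'"
    by (subst (1 2) decomposition_c_part[OF assms])
      (simp add: i_add E.Mod.scale_left_distrib)
  then show ?thesis by (metis c_part_decomposition assms)
qed

lemma c_part_scale:
  assumes "p v' = v"
  shows "c_part v' (mscale E u e) = poly u \<eta> * c_part v' e"
proof -
  have "mscale E u e = i (poly u \<eta> * c_part v' e) + mscale E (u * coord_v (p e)) v'"
    by (subst decomposition_c_part[OF assms])
      (simp add: i_scale E.Mod.scale_right_distrib)
  then show ?thesis by (metis c_part_decomposition assms)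
qed

lemma c_part_i: "p v' = v \<Longrightarrow> c_part v' (i x) = x"
  using c_part_decomposition[of v' x 0] by simp

lemma c_part_action:
  assumes "lift E i p v' f g"
  shows "c_part v' (action E a l e) = poly (coord_v (p e)) (\<eta> + l) *
    (poly (coord_A a) (- l) * poly f l + poly (coord_B a) (- l) * poly g l)"
proof -
  have v': "p v' = v" using assms by (simp add: lift_def)
  show ?thesis
    by (subst decomposition_c_part[OF v', of e]) (simp only: action_lift[OF assms] c_part_decomposition[OF v'])
qed

lemma lift_unique:
  assumes "lift E i p v' f g" "lift E i p v' f' g'"
  shows "f = f'" "g = g'"
  using assms by (auto simp: lift_def i_eq_iff intro!: poly_ext)

text \<open>
  These are the \<open>c\<^sub>\<eta>\<close>-components of the Jacobi identities on \<open>v'\<close> for the pairs \<open>A, A\<close>, then \<open>A, B\<close>,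
  then \<open>B, B\<close>.
\<close>

lemma lift_equations:
  assumes "lift E i p v' f g"
  shows "\<delta>\<^sub>1 * (\<beta> + \<eta> + l + \<alpha> * m) * poly f l - \<delta>\<^sub>1 * (\<beta> + \<eta> + m + \<alpha> * l) * poly f m =
      (l - m) * poly f (l + m)"
    and "\<delta>\<^sub>2 * poly \<phi> m * poly f l = \<delta>\<^sub>1 * (\<beta> + \<eta> + m + \<alpha> * l) * poly g m"
    and "\<delta>\<^sub>2 * poly \<phi> m * poly g l = \<delta>\<^sub>2 * poly \<phi> l * poly g m"
proof -
  have v': "p v' = v" using assms by (simp add: lift_def)
  note cp = c_part_action[OF assms] c_part_add[OF v'] c_part_scale[OF v'] p_action v' action_A action_B
    E.action_scale_left bracket_AA bracket_AB bracket_BB E.action_zero_left c_part_i[OF v', of 0, simplified]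
  have "c_part v' (action E A l (action E A m v')) = c_part v' (action E (bracket R A l A) (l + m) v') +
      c_part v' (action E A m (action E A l v'))"
    by (subst E.action_jacobi) (rule c_part_add[OF v'])
  then show "\<delta>\<^sub>1 * (\<beta> + \<eta> + l + \<alpha> * m) * poly f l - \<delta>\<^sub>1 * (\<beta> + \<eta> + m + \<alpha> * l) * poly f m =
      (l - m) * poly f (l + m)"
    by (simp add: cp) (simp add: algebra_simps)
  have "c_part v' (action E A l (action E B m v')) = c_part v' (action E (bracket R A l B) (l + m) v') +
      c_part v' (action E B m (action E A l v'))"
    by (subst E.action_jacobi) (rule c_part_add[OF v'])
  then show "\<delta>\<^sub>2 * poly \<phi> m * poly f l = \<delta>\<^sub>1 * (\<beta> + \<eta> + m + \<alpha> * l) * poly g m"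
    by (simp add: cp) (simp add: algebra_simps)
  have "c_part v' (action E B l (action E B m v')) = c_part v' (action E (bracket R B l B) (l + m) v') +
      c_part v' (action E B m (action E B l v'))"
    by (subst E.action_jacobi) (rule c_part_add[OF v'])
  then show "\<delta>\<^sub>2 * poly \<phi> m * poly g l = \<delta>\<^sub>2 * poly \<phi> l * poly g m"
    by (simp add: cp)
qed

text \<open>
  The second conclusion records that \<open>f\<close> changes only in degrees 0 and 1, so that a nonzero
  coefficient of degree 2 or 3 can be read off from any lift.
\<close>

lemma normal_lift:
  assumes "lift E i p v' f g"
  obtains k f' where "lift E i p (v' + i k) f' 0"
    and "f' = f - Polynomial.smult (k * \<delta>\<^sub>1) [:\<beta> + \<eta>, \<alpha>:]"
    and "f' = 0 \<or> (\<delta>\<^sub>1, \<delta>\<^sub>2) = (1, 0) \<and> \<beta> + \<eta> = 0 \<and>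
      (\<exists>s. s \<noteq> 0 \<and> (\<alpha> = 1 \<and> f' = monom s 2 \<or> \<alpha> = 2 \<and> f' = monom s 3))"
proof (cases "\<delta>\<^sub>1 = 1 \<and> \<delta>\<^sub>2 = 0")
  case True
  note eqs = lift_equations[OF assms]
  obtain k r where f: "f = [:k * (\<beta> + \<eta>), k * \<alpha>:] + r"
    and r: "r = 0 \<or> \<beta> + \<eta> = 0 \<and> (\<exists>s. s \<noteq> 0 \<and> (\<alpha> = 1 \<and> r = monom s 2 \<or> \<alpha> = 2 \<and> r = monom s 3))"
    using virasoro_cocycle_polynomial[OF alpha, of "\<beta> + \<eta>" f] eqs(1) True by auto
  have "g = 0"
  proof (rule poly_ext)
    fix m
    \<comment> \<open>This value of \<open>l\<close> makes the factor in front of \<open>g(m)\<close> equal to 1.\<close>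
    have "(\<beta> + \<eta> + m + \<alpha> * ((1 - (\<beta> + \<eta> + m)) / \<alpha>)) * poly g m = 0"
      using eqs(2)[of m "(1 - (\<beta> + \<eta> + m)) / \<alpha>"] True by simp
    then show "poly g m = poly 0 m" using alpha by simp
  qed
  with lift_translate[OF assms, of k] have "lift E i p (v' + i k) r 0"
    using True by (simp add: f)
  then show ?thesis
    using r True by (intro that[of k r]) (simp_all add: f)
next
  case False
  then have \<delta>: "\<delta>\<^sub>1 = 0" "\<delta>\<^sub>2 = 1" using deltas by auto
  note eqs = lift_equations[OF assms]
  obtain m where m: "poly \<phi> m \<noteq> 0" using phi poly_all_0_iff_0 by blast
  have "f = 0"
    by (rule poly_ext) (use eqs(2)[of m] m \<delta> in simp)
  moreover have "g = Polynomial.smult (poly g m / poly \<phi> m) \<phi>"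
    by (rule poly_ext) (use eqs(3)[of m] m \<delta> in \<open>simp add: field_simps\<close>)
  ultimately have "lift E i p (v' + i (poly g m / poly \<phi> m)) 0 0"
    using lift_translate[OF assms, of "poly g m / poly \<phi> m"] \<delta> by simp
  then show ?thesis
    by (intro that[of _ 0]) (simp_all add: \<open>f = 0\<close> \<delta>)
qed

end

context type_I_rank_one
begin

section \<open>Comparison and construction of extensions\<close>

text \<open>
  The equivalence sends \<open>x c\<^sub>\<eta> + q(\<partial>)v'\<close> to \<open>x c\<^sub>\<eta> + q(\<partial>)v''\<close>; it commutes with the action because
  \<open>action_lift\<close> gives the same formula on both sides.
\<close>

lemma equal_lifts_equivalent:
  fixes E :: "('r, 'e::ab_group_add) conf_mod" and E' :: "('r, 'f::ab_group_add) conf_mod"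
  assumes "extension R (one_dim_mod \<eta>) V E i p" and lift: "lift E i p v' f g"
    and "extension R (one_dim_mod \<eta>) V E' i' p'" and lift': "lift E' i' p' v'' f g"
  shows "ext_equivalent E i p E' i' p'"
proof -
  interpret X: rank_one_extension R A B V v \<delta>\<^sub>1 \<delta>\<^sub>2 \<alpha> \<beta> \<phi> \<eta> E i p
    by unfold_locales (rule assms)
  interpret Y: rank_one_extension R A B V v \<delta>\<^sub>1 \<delta>\<^sub>2 \<alpha> \<beta> \<phi> \<eta> E' i' p'
    by unfold_locales (rule assms)
  have v': "p v' = v" and v'': "p' v'' = v" using lift lift' by (simp_all add: lift_def)
  define h where "h e = i' (X.c_part v' e) + mscale E' (coord_v (p e)) v''" for e
  have h: "h (i x + mscale E q v') = i' x + mscale E' q v''" for x q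
    by (simp add: h_def X.c_part_decomposition[OF v'] X.p_add X.p_i X.p_scale v')
  have "h (e + e') = h e + h e'" for e e'
    by (simp add: h_def X.c_part_add[OF v'] X.p_add Y.i_add Y.E.Mod.scale_left_distrib)
  moreover have "h (mscale E u e) = mscale E' u (h e)" for u e
    by (simp add: h_def X.c_part_scale[OF v'] X.p_scale Y.i_scale Y.E.Mod.scale_right_distrib)
  moreover have "h (action E a l e) = action E' a l (h e)" for a l e
  proof -
    obtain x q where e: "e = i x + mscale E q v'" using X.decomposition[OF v'] .
    show ?thesis by (simp only: e h X.action_lift[OF lift] Y.action_lift[OF lift'])
  qed
  ultimately have "conf_hom E E' h"
    by (simp add: conf_hom_def module_hom_iff X.E.module_V Y.E.module_V)
  moreover have "h (i x) = i' x" for x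
    using h[of x 0] by simp
  moreover have "p' (h e) = p e" for e
    by (simp add: h_def Y.p_add Y.p_i Y.p_scale v'' coord_v)
  ultimately show ?thesis by (auto simp: ext_equivalent_def)
qed

lemma lift_transport:
  fixes E :: "('r, 'e::ab_group_add) conf_mod" and E' :: "('r, 'f::ab_group_add) conf_mod"
  assumes h: "conf_hom E E' h" "\<And>x. h (i x) = i' x" "\<And>e. p' (h e) = p e"
    and lift: "lift E i p v' f g"
  shows "lift E' i' p' (h v') f g"
proof -
  have "action E' a l (h v') = h (action E a l v')" for a l
    using h(1) by (simp add: conf_hom_def)
  moreover have "h (mscale E u e + i x) = mscale E' u (h e) + i' x" for u e x
    using h(1,2) by (simp add: conf_hom_def module_hom_iff)
  ultimately show ?thesis
    using lift h(3) by (simp add: lift_def)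
qed

lemma coord_v_action:
  "coord_v (action V a l w) = (coord_v w \<circ>\<^sub>p [:l, 1:]) *
    ([:poly (coord_A a) (- l):] * [:\<delta>\<^sub>1 * (\<alpha> * l + \<beta>), \<delta>\<^sub>1:] +
     [:poly (coord_B a) (- l):] * [:\<delta>\<^sub>2 * poly \<phi> l:])"
proof -
  have "action V a l w = mscale V (coord_v w \<circ>\<^sub>p [:l, 1:]) (action V a l v)"
    by (simp only: V.action_scale_right[symmetric] coord_v)
  also have "action V a l v = action V (ascale R (coord_A a) A + ascale R (coord_B a) B) l v"
    by (simp only: coord_AB[symmetric])
  finally show ?thesis
    by (simp only: V.action_add_left V.action_scale_left action_A action_B coord_v_simps mult_1_right)
qed

lemma coord_A_bracket:
  "coord_A (bracket R a l b) =
    [:poly (coord_A a) (- l):] * ((coord_A b \<circ>\<^sub>p [:l, 1:]) * [:2 * l, 1:])"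
proof -
  interpret J: conformal_module R "adjoint_mod R"
    by (rule conformal_module_adjoint) (rule V.lie_conformal_algebra_axioms)
  have sc: "mscale (adjoint_mod R) = ascale R" by (simp add: adjoint_mod_def)
  note J = J.action_add_left J.action_add_right J.action_scale_left J.action_scale_right
  have "bracket R a l b = bracket R (ascale R (coord_A a) A + ascale R (coord_B a) B) l
      (ascale R (coord_A b) A + ascale R (coord_B b) B)"
    by (simp only: coord_AB[symmetric])
  then show ?thesis
    by (simp add: J[unfolded sc action_adjoint_mod] bracket_AA bracket_AB bracket_BA bracket_BB
        del: mult_pCons_left mult_pCons_right)
qed

text \<open>
  For \<open>a = P(\<partial>)A + Q(\<partial>)B\<close> and \<open>w = q(\<partial>)v\<close> the twist is \<open>P(-\<lambda>) f(\<lambda>) q(\<eta> + \<lambda>)\<close>. By \<open>action_lift\<close>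
  this is the only choice with \<open>A\<^sub>\<lambda> v\<close> twisted by \<open>f\<close>, \<open>B\<^sub>\<lambda> v\<close> untwisted, and \<open>\<partial>\<close> acting as on the
  direct sum.
\<close>

definition virasoro_twist :: "complex \<Rightarrow> complex poly \<Rightarrow> ('r, complex, 'v) ext_data" where
  "virasoro_twist \<eta> f = (\<lambda>u w. 0, \<lambda>a w. (coord_A a \<circ>\<^sub>p [:0, -1:]) * f * (coord_v w \<circ>\<^sub>p [:\<eta>, 1:]))"

text \<open>
  With \<open>b = 0\<close> and \<open>\<delta>\<^sub>1 = 1\<close>, every term of the Jacobi identity for \<open>a, b\<close> on \<open>w\<close> is the same product
  \<open>P(-l) P'(-m) q(\<eta> + l + m)\<close> times a term of the functional equation for \<open>f\<close>.
\<close>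

lemma ext_cocycle_virasoro_twist:
  assumes \<delta>: "(\<delta>\<^sub>1, \<delta>\<^sub>2) = (1, 0)" and b: "\<beta> + \<eta> = 0"
    and f: "\<And>l m. (l + \<alpha> * m) * poly f l - (m + \<alpha> * l) * poly f m = (l - m) * poly f (l + m)"
  shows "virasoro_twist \<eta> f \<in> ext_cocycles R V (one_dim_mod \<eta>)"
  unfolding mem_ext_cocycles_iff[OF V.conformal_module_axioms]
proof
  have psi: "poly (snd (virasoro_twist \<eta> f) a w) l = poly (coord_A a) (- l) * poly f l * poly (coord_v w) (\<eta> + l)"
    for a w l by (simp add: virasoro_twist_def poly_pcompose)
  fix u u' w w' a b l m and c :: complex
  show "fst (virasoro_twist \<eta> f) [:c:] w = 0"
    and "fst (virasoro_twist \<eta> f) u (w + w') = fst (virasoro_twist \<eta> f) u w + fst (virasoro_twist \<eta> f) u w'"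
    and "fst (virasoro_twist \<eta> f) (u + u') w = fst (virasoro_twist \<eta> f) u w + fst (virasoro_twist \<eta> f) u' w"
    and "fst (virasoro_twist \<eta> f) (u * u') w =
      poly u \<eta> * fst (virasoro_twist \<eta> f) u' w + fst (virasoro_twist \<eta> f) u (mscale V u' w)"
    by (simp_all add: virasoro_twist_def)
  show "poly (snd (virasoro_twist \<eta> f) (a + b) w) l =
      poly (snd (virasoro_twist \<eta> f) a w) l + poly (snd (virasoro_twist \<eta> f) b w) l"
    and "poly (snd (virasoro_twist \<eta> f) (ascale R [:c:] a) w) l = c * poly (snd (virasoro_twist \<eta> f) a w) l"
    and "poly (snd (virasoro_twist \<eta> f) a (w + w')) l =
      poly (snd (virasoro_twist \<eta> f) a w) l + poly (snd (virasoro_twist \<eta> f) a w') l"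
    and "poly (snd (virasoro_twist \<eta> f) a (mscale V [:c:] w)) l = c * poly (snd (virasoro_twist \<eta> f) a w) l"
    and "poly (snd (virasoro_twist \<eta> f) (ascale R [:0, 1:] a) w) l = - l * poly (snd (virasoro_twist \<eta> f) a w) l"
    by (simp_all add: psi algebra_simps)
  show "poly (snd (virasoro_twist \<eta> f) a (mscale V [:0, 1:] w)) l =
      (l + \<eta>) * poly (snd (virasoro_twist \<eta> f) a w) l + fst (virasoro_twist \<eta> f) [:l, 1:] (action V a l w)"
    by (simp add: psi) (simp add: virasoro_twist_def algebra_simps)
  define q where "q = poly (coord_v w) (\<eta> + l + m)"
  define P where "P = poly (coord_A a) (- l)"
  define P' where "P' = poly (coord_A b) (- m)"
  have 1: "poly (snd (virasoro_twist \<eta> f) a (action V b m w)) l = P * P' * q * ((l + \<alpha> * m + (\<beta> + \<eta>)) * poly f l)"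
    using \<delta> by (simp add: psi coord_v_action poly_pcompose P_def P'_def q_def add.commute add.left_commute)
      (simp add: algebra_simps)
  have 2: "poly (snd (virasoro_twist \<eta> f) b (action V a l w)) m = P * P' * q * ((m + \<alpha> * l + (\<beta> + \<eta>)) * poly f m)"
    using \<delta> by (simp add: psi coord_v_action poly_pcompose P_def P'_def q_def add.commute add.left_commute)
      (simp add: algebra_simps)
  have 3: "poly (snd (virasoro_twist \<eta> f) (bracket R a l b) w) (l + m) = P * P' * q * ((l - m) * poly f (l + m))"
    by (simp add: psi coord_A_bracket poly_pcompose P_def P'_def q_def add.assoc)
      (simp add: algebra_simps)
  show "poly (snd (virasoro_twist \<eta> f) a (action V b m w)) l =
      poly (snd (virasoro_twist \<eta> f) (bracket R a l b) w) (l + m) +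
      poly (snd (virasoro_twist \<eta> f) b (action V a l w)) m"
    unfolding 1 2 3 b f[symmetric] by (simp add: algebra_simps)
qed

lemma zero_ext_cocycle: "(\<lambda>_ _. 0, \<lambda>_ _. 0) \<in> ext_cocycles R V (one_dim_mod \<eta>)"
  by (simp add: mem_ext_cocycles_iff ext_cocycle_zero V.conformal_module_axioms)

text \<open>
  The correction by \<open>d\<close> is constant in \<open>\<lambda>\<close>: applying \<open>\<delta>\<^sub>1(\<partial> + \<alpha>\<lambda> + \<beta>)\<close> to \<open>(0, v)\<close> in the twisted
  module produces the \<open>c\<^sub>\<eta>\<close>-component \<open>d(\<delta>\<^sub>1\<partial>, v)\<close>, because \<open>d\<close> vanishes on constants.
\<close>

lemma lift_twisted_mod:
  assumes "z \<in> ext_cocycles R V (one_dim_mod \<eta>)"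
  shows "lift (twisted_mod (one_dim_mod \<eta>) V z) (\<lambda>x. (x, 0)) snd (0, v)
    (snd z A v - [:fst z [:0, \<delta>\<^sub>1:] v:]) (snd z B v)"
proof -
  let ?T = "twisted_mod (one_dim_mod \<eta>) V z"
  interpret Z: ext_cocycle R V \<eta> "fst z" "snd z"
    using assms by (simp add: mem_ext_cocycles_iff[OF V.conformal_module_axioms])
  have act: "action ?T a l (x, w) = (poly (snd z a w) l, action V a l w)" for a l x w
    by (rule action_twisted_mod) (rule V.module_V Z.d_const)+
  have "fst z [:c, \<delta>\<^sub>1:] v = fst z [:0, \<delta>\<^sub>1:] v" for c
    using Z.d_add_left[of "[:c:]" "[:0, \<delta>\<^sub>1:]" v] by (simp add: Z.d_const)
  then show ?thesis
    by (simp add: lift_def act mscale_twisted_mod Z.d_const action_A action_B)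
qed

section \<open>Nontrivial extensions and the space Ext\<close>

lemma lift_twisted_zero:
  "lift (twisted_mod (one_dim_mod \<eta>) V (\<lambda>_ _. 0, \<lambda>_ _. 0)) (\<lambda>x. (x, 0)) snd (0, v) 0 0"
  using lift_twisted_mod[OF zero_ext_cocycle] by simp

lemma extension_twisted_cocycle:
  "z \<in> ext_cocycles R V (one_dim_mod \<eta>) \<Longrightarrow>
    extension R (one_dim_mod \<eta>) V (twisted_mod (one_dim_mod \<eta>) V z) (\<lambda>x. (x, 0)) snd"
  by (simp add: ext_cocycles_def)

lemma ext_trivialI:
  assumes "extension R (one_dim_mod \<eta>) V E i p" and "lift E i p v' 0 0"
  shows "ext_trivial (one_dim_mod \<eta>) V E i p"
  unfolding ext_trivial_def direct_sum_eq_twisted_zero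
  using assms extension_twisted_cocycle[OF zero_ext_cocycle] lift_twisted_zero
  by (rule equal_lifts_equivalent)

text \<open>
  The equivalence with the direct sum carries the given lift to some \<open>(k, v)\<close>, a translate of the
  lift \<open>(0, v)\<close>, for which both polynomials are 0.
\<close>

lemma ext_trivialD:
  assumes "ext_trivial (one_dim_mod \<eta>) V E i p" and "lift E i p v' f g"
  shows "\<exists>k. f = Polynomial.smult k [:\<beta> + \<eta>, \<alpha>:]"
proof -
  let ?D = "twisted_mod (one_dim_mod \<eta>) V (\<lambda>_ _. 0, \<lambda>_ _. 0)"
  interpret D: rank_one_extension R A B V v \<delta>\<^sub>1 \<delta>\<^sub>2 \<alpha> \<beta> \<phi> \<eta> ?D "\<lambda>x. (x, 0)" snd
    by unfold_locales (rule extension_twisted_cocycle[OF zero_ext_cocycle])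
  obtain h where h: "conf_hom E ?D h" "\<And>x. h (i x) = (x, 0)" "\<And>e. snd (h e) = p e"
    using assms(1) unfolding ext_trivial_def ext_equivalent_def direct_sum_eq_twisted_zero by blast
  have lift: "lift ?D (\<lambda>x. (x, 0)) snd (h v') f g"
    using h assms(2) by (rule lift_transport)
  have "h v' = (0, v) + (fst (h v'), 0)"
    using lift by (simp add: lift_def prod_eq_iff)
  with D.lift_translate[OF lift_twisted_zero, of "fst (h v')"]
  have "lift ?D (\<lambda>x. (x, 0)) snd (h v')
      (- Polynomial.smult (fst (h v') * \<delta>\<^sub>1) [:\<beta> + \<eta>, \<alpha>:]) (- Polynomial.smult (fst (h v') * \<delta>\<^sub>2) \<phi>)"
    by simp
  from D.lift_unique(1)[OF lift this] show ?thesis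
    by (intro exI[of _ "- (fst (h v') * \<delta>\<^sub>1)"]) simp
qed

text \<open>
  In degree \<open>n = \<alpha> + 1 \<ge> 2\<close>, neither the constant correction by \<open>d\<close> nor a change of lift affects
  \<open>f\<close>. The coefficient of this degree is therefore the same in the normal form, which is a monomial
  of degree \<open>n\<close> or zero.
\<close>

lemma trivial_cocycles_eq_kernel:
  assumes \<delta>: "(\<delta>\<^sub>1, \<delta>\<^sub>2) = (1, 0)" and b: "\<beta> + \<eta> = 0" and n: "\<alpha> = 1 \<and> n = 2 \<or> \<alpha> = 2 \<and> n = 3"
  shows "trivial_cocycles R V (one_dim_mod \<eta>) =
    {z \<in> ext_cocycles R V (one_dim_mod \<eta>). coeff (snd z A v) n = 0}"
proof -
  have "ext_trivial (one_dim_mod \<eta>) V (twisted_mod (one_dim_mod \<eta>) V z) (\<lambda>x. (x, 0)) snd \<longleftrightarrow>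
      coeff (snd z A v) n = 0" (is "ext_trivial _ _ ?T ?i ?p \<longleftrightarrow> _")
    if z: "z \<in> ext_cocycles R V (one_dim_mod \<eta>)" for z
  proof -
    interpret T: rank_one_extension R A B V v \<delta>\<^sub>1 \<delta>\<^sub>2 \<alpha> \<beta> \<phi> \<eta> ?T ?i ?p
      by unfold_locales (rule extension_twisted_cocycle[OF z])
    define f where "f = snd z A v - [:fst z [:0, \<delta>\<^sub>1:] v:]"
    have lift: "lift ?T ?i ?p (0, v) f (snd z B v)"
      using lift_twisted_mod[OF z] by (simp add: f_def)
    have low: "coeff [:x, y:] n = 0" "coeff [:x:] n = 0" for x y :: complex
      using n by (auto simp: numeral_2_eq_2 numeral_3_eq_3)
    have coeff_f: "coeff f n = coeff (snd z A v) n" by (simp add: f_def low)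
    obtain k f' where lift': "lift ?T ?i ?p ((0, v) + ?i k) f' 0"
      and f': "f' = f - Polynomial.smult (k * \<delta>\<^sub>1) [:\<beta> + \<eta>, \<alpha>:]"
      and cases: "f' = 0 \<or> (\<delta>\<^sub>1, \<delta>\<^sub>2) = (1, 0) \<and> \<beta> + \<eta> = 0 \<and>
        (\<exists>s. s \<noteq> 0 \<and> (\<alpha> = 1 \<and> f' = monom s 2 \<or> \<alpha> = 2 \<and> f' = monom s 3))"
      using T.normal_lift[OF lift] .
    have coeff_f': "coeff f' n = coeff f n" by (simp add: f' low)
    show ?thesis
    proof
      assume "ext_trivial (one_dim_mod \<eta>) V ?T ?i ?p"
      from ext_trivialD[OF this lift] show "coeff (snd z A v) n = 0"
        by (auto simp: low simp flip: coeff_f)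
    next
      assume "coeff (snd z A v) n = 0"
      then have "coeff f' n = 0" by (simp add: coeff_f coeff_f')
      then have "f' = 0" using cases n by auto
      then show "ext_trivial (one_dim_mod \<eta>) V ?T ?i ?p"
        using ext_trivialI[OF T.ext] lift' by simp
    qed
  qed
  then show ?thesis by (auto simp: trivial_cocycles_def)
qed

lemma snd_virasoro_twist: "snd (virasoro_twist \<eta> f) A v = f" "snd (virasoro_twist \<eta> f) B v = 0"
  by (simp_all add: virasoro_twist_def pcompose_1)

lemma lift_virasoro_twist:
  assumes "virasoro_twist \<eta> f \<in> ext_cocycles R V (one_dim_mod \<eta>)"
  shows "lift (twisted_mod (one_dim_mod \<eta>) V (virasoro_twist \<eta> f)) (\<lambda>x. (x, 0)) snd (0, v) f 0"
proof -
  have "fst (virasoro_twist \<eta> f) u w = 0" for u w by (simp add: virasoro_twist_def)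
  then show ?thesis using lift_twisted_mod[OF assms] by (simp add: snd_virasoro_twist)
qed

lemma Ext_space_one_dimensional:
  assumes \<delta>: "(\<delta>\<^sub>1, \<delta>\<^sub>2) = (1, 0)" and \<alpha>: "\<alpha> \<in> {1, 2}" and b: "\<beta> + \<eta> = 0"
  shows "vectorspace class_ring (Ext_space R V (one_dim_mod \<eta>))"
    and "vectorspace.fin_dim class_ring (Ext_space R V (one_dim_mod \<eta>))"
    and "vectorspace.dim class_ring (Ext_space R V (one_dim_mod \<eta>)) = 1"
proof -
  obtain n :: nat where n: "\<alpha> = 1 \<and> n = 2 \<or> \<alpha> = 2 \<and> n = 3" using \<alpha> by auto
  let ?M = "cocycle_space R V (one_dim_mod \<eta>)"
  let ?L = "\<lambda>z :: ('r, complex, 'v) ext_data. coeff (snd z A v) n"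
  have M: "Module.module class_ring ?M"
    by (rule module_cocycle_space[OF V.conformal_module_axioms])
  have add: "?L (x \<oplus>\<^bsub>?M\<^esub> y) = ?L x + ?L y" for x y
    by (simp add: cocycle_space_def)
  have smult: "?L (c \<odot>\<^bsub>?M\<^esub> x) = c * ?L x" for c x
    by (simp add: cocycle_space_def coeff_map_poly mscale_one_dim_mod)
  have twist: "virasoro_twist \<eta> (monom 1 n) \<in> carrier ?M"
    using ext_cocycle_virasoro_twist[OF \<delta> b] virasoro_cocycle_monom[of \<alpha> _ 1] n
    by (auto simp: cocycle_space_def)
  have one: "?L (virasoro_twist \<eta> (monom 1 n)) = 1"
    by (simp add: snd_virasoro_twist)
  have N: "trivial_cocycles R V (one_dim_mod \<eta>) = {z \<in> carrier ?M. ?L z = 0}"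
    by (simp add: trivial_cocycles_eq_kernel[OF \<delta> b n] cocycle_space_def)
  note * = vectorspace_onto_class_ring[of ?M ?L, OF M add smult twist one N, folded Ext_space_def]
  show "vectorspace class_ring (Ext_space R V (one_dim_mod \<eta>))"
    and "vectorspace.fin_dim class_ring (Ext_space R V (one_dim_mod \<eta>))"
    and "vectorspace.dim class_ring (Ext_space R V (one_dim_mod \<eta>)) = 1"
    by (fact *)+
qed

lemma nontrivial_extension:
  assumes "extension R (one_dim_mod \<eta>) V E i p" and "\<not> ext_trivial (one_dim_mod \<eta>) V E i p"
  shows "(\<delta>\<^sub>1, \<delta>\<^sub>2) = (1, 0)" and "\<alpha> \<in> {1, 2}" and "\<beta> + \<eta> = 0"
    and "\<exists>s f. s \<noteq> 0 \<and> (\<alpha> = 1 \<and> f = monom s 2 \<or> \<alpha> = 2 \<and> f = monom s 3) \<and>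
      (\<exists>(E' :: ('r, complex \<times> 'v) conf_mod) i' p'.
        extension R (one_dim_mod \<eta>) V E' i' p' \<and>
        standard_form A B v \<delta>\<^sub>1 \<delta>\<^sub>2 \<alpha> \<beta> \<phi> \<eta> E' i' p' f 0 \<and>
        ext_equivalent E i p E' i' p')"
proof -
  interpret E: rank_one_extension R A B V v \<delta>\<^sub>1 \<delta>\<^sub>2 \<alpha> \<beta> \<phi> \<eta> E i p
    by unfold_locales (rule assms)
  obtain v' where "p v' = v" using E.p_surj by blast
  then obtain f\<^sub>0 g where "lift E i p v' f\<^sub>0 g" using E.lift_exists by blast
  then obtain k f where lift: "lift E i p (v' + i k) f 0"
    and cases: "f = 0 \<or> (\<delta>\<^sub>1, \<delta>\<^sub>2) = (1, 0) \<and> \<beta> + \<eta> = 0 \<and>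
      (\<exists>s. s \<noteq> 0 \<and> (\<alpha> = 1 \<and> f = monom s 2 \<or> \<alpha> = 2 \<and> f = monom s 3))"
    by (rule E.normal_lift)
  have "f \<noteq> 0" using ext_trivialI[OF assms(1)] assms(2) lift by blast
  with cases obtain s where \<delta>: "(\<delta>\<^sub>1, \<delta>\<^sub>2) = (1, 0)" and b: "\<beta> + \<eta> = 0" and "s \<noteq> 0"
    and f: "\<alpha> = 1 \<and> f = monom s 2 \<or> \<alpha> = 2 \<and> f = monom s 3" by blast
  show "(\<delta>\<^sub>1, \<delta>\<^sub>2) = (1, 0)" and "\<alpha> \<in> {1, 2}" and "\<beta> + \<eta> = 0"
    using \<delta> b f by auto
  let ?z = "virasoro_twist \<eta> f"
  have z: "?z \<in> ext_cocycles R V (one_dim_mod \<eta>)"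
    by (rule ext_cocycle_virasoro_twist[OF \<delta> b virasoro_cocycle_monom[OF f]])
  interpret T: rank_one_extension R A B V v \<delta>\<^sub>1 \<delta>\<^sub>2 \<alpha> \<beta> \<phi> \<eta>
      "twisted_mod (one_dim_mod \<eta>) V ?z" "\<lambda>x. (x, 0)" snd
    by unfold_locales (rule extension_twisted_cocycle[OF z])
  note lift_T = lift_virasoro_twist[OF z]
  have "ext_equivalent E i p (twisted_mod (one_dim_mod \<eta>) V ?z) (\<lambda>x. (x, 0)) snd"
    by (rule equal_lifts_equivalent[OF assms(1) lift T.ext lift_T])
  with \<open>s \<noteq> 0\<close> f T.ext T.standard_form_lift[OF lift_T]
  show "\<exists>s f. s \<noteq> 0 \<and> (\<alpha> = 1 \<and> f = monom s 2 \<or> \<alpha> = 2 \<and> f = monom s 3) \<and>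
      (\<exists>(E' :: ('r, complex \<times> 'v) conf_mod) i' p'.
        extension R (one_dim_mod \<eta>) V E' i' p' \<and>
        standard_form A B v \<delta>\<^sub>1 \<delta>\<^sub>2 \<alpha> \<beta> \<phi> \<eta> E' i' p' f 0 \<and>
        ext_equivalent E i p E' i' p')"
    by blast
qed

lemma exists_nontrivial_extension:
  assumes \<delta>: "(\<delta>\<^sub>1, \<delta>\<^sub>2) = (1, 0)" and b: "\<beta> + \<eta> = 0" and "s \<noteq> 0"
    and f: "\<alpha> = 1 \<and> f = monom s 2 \<or> \<alpha> = 2 \<and> f = monom s 3"
  shows "\<exists>(E :: ('r, complex \<times> 'v) conf_mod) i p.
    extension R (one_dim_mod \<eta>) V E i p \<and>
    standard_form A B v \<delta>\<^sub>1 \<delta>\<^sub>2 \<alpha> \<beta> \<phi> \<eta> E i p f 0 \<and>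
    \<not> ext_trivial (one_dim_mod \<eta>) V E i p"
proof -
  let ?z = "virasoro_twist \<eta> f"
  have z: "?z \<in> ext_cocycles R V (one_dim_mod \<eta>)"
    by (rule ext_cocycle_virasoro_twist[OF \<delta> b virasoro_cocycle_monom[OF f]])
  interpret T: rank_one_extension R A B V v \<delta>\<^sub>1 \<delta>\<^sub>2 \<alpha> \<beta> \<phi> \<eta>
      "twisted_mod (one_dim_mod \<eta>) V ?z" "\<lambda>x. (x, 0)" snd
    by unfold_locales (rule extension_twisted_cocycle[OF z])
  note lift_T = lift_virasoro_twist[OF z]
  have "\<not> ext_trivial (one_dim_mod \<eta>) V (twisted_mod (one_dim_mod \<eta>) V ?z) (\<lambda>x. (x, 0)) snd"
  proof
    assume "ext_trivial (one_dim_mod \<eta>) V (twisted_mod (one_dim_mod \<eta>) V ?z) (\<lambda>x. (x, 0)) snd"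
    from ext_trivialD[OF this lift_T] obtain k where "f = Polynomial.smult k [:\<beta> + \<eta>, \<alpha>:]" ..
    then have "degree f \<le> 1" by simp
    then show False using f \<open>s \<noteq> 0\<close> by (auto simp: degree_monom_eq)
  qed
  then show ?thesis using T.ext T.standard_form_lift[OF lift_T] by blast
qed

end

theorem theorem5p2:
  fixes R :: "'r::ab_group_add conf_alg" and A B :: 'r
    and V :: "('r, 'v::ab_group_add) conf_mod" and v :: 'v
    and \<delta>\<^sub>1 \<delta>\<^sub>2 \<alpha> \<beta> \<eta> :: complex and \<phi> :: "complex poly"
  assumes R: "type_I_algebra R A B"
    and V: "type_I_module R A B V v \<delta>\<^sub>1 \<delta>\<^sub>2 \<alpha> \<beta> \<phi>"
  shows
    "(\<forall>(E :: ('r, 'e::ab_group_add) conf_mod) i p.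
        extension R (one_dim_mod \<eta>) V E i p \<longrightarrow>
          (\<exists>f g. standard_form A B v \<delta>\<^sub>1 \<delta>\<^sub>2 \<alpha> \<beta> \<phi> \<eta> E i p f g)) \<and>
     (\<forall>(E :: ('r, 'e) conf_mod) i p.
        extension R (one_dim_mod \<eta>) V E i p \<and> \<not> ext_trivial (one_dim_mod \<eta>) V E i p \<longrightarrow>
          (\<delta>\<^sub>1, \<delta>\<^sub>2) = (1, 0) \<and> \<alpha> \<in> {1, 2} \<and> \<beta> + \<eta> = 0 \<and>
          (\<exists>s f. s \<noteq> 0 \<and> (\<alpha> = 1 \<and> f = monom s 2 \<or> \<alpha> = 2 \<and> f = monom s 3) \<and>
            (\<exists>(E' :: ('r, complex \<times> 'v) conf_mod) i' p'.
              extension R (one_dim_mod \<eta>) V E' i' p' \<and>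
              standard_form A B v \<delta>\<^sub>1 \<delta>\<^sub>2 \<alpha> \<beta> \<phi> \<eta> E' i' p' f 0 \<and>
              ext_equivalent E i p E' i' p'))) \<and>
     ((\<delta>\<^sub>1, \<delta>\<^sub>2) = (1, 0) \<and> \<alpha> \<in> {1, 2} \<and> \<beta> + \<eta> = 0 \<longrightarrow>
        (\<forall>s f. s \<noteq> 0 \<and> (\<alpha> = 1 \<and> f = monom s 2 \<or> \<alpha> = 2 \<and> f = monom s 3) \<longrightarrow>
          (\<exists>(E :: ('r, complex \<times> 'v) conf_mod) i p.
            extension R (one_dim_mod \<eta>) V E i p \<and>
            standard_form A B v \<delta>\<^sub>1 \<delta>\<^sub>2 \<alpha> \<beta> \<phi> \<eta> E i p f 0 \<and>
            \<not> ext_trivial (one_dim_mod \<eta>) V E i p)) \<and>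
        vectorspace class_ring (Ext_space R V (one_dim_mod \<eta>)) \<and>
        vectorspace.fin_dim class_ring (Ext_space R V (one_dim_mod \<eta>)) \<and>
        vectorspace.dim class_ring (Ext_space R V (one_dim_mod \<eta>)) = 1)"
proof -
  interpret type_I_rank_one R A B V v \<delta>\<^sub>1 \<delta>\<^sub>2 \<alpha> \<beta> \<phi>
    by unfold_locales (fact R V)+
  have "\<exists>f g. standard_form A B v \<delta>\<^sub>1 \<delta>\<^sub>2 \<alpha> \<beta> \<phi> \<eta> E i p f g"
    if "extension R (one_dim_mod \<eta>) V E i p" for E :: "('r, 'e) conf_mod" and i p
  proof -
    interpret rank_one_extension R A B V v \<delta>\<^sub>1 \<delta>\<^sub>2 \<alpha> \<beta> \<phi> \<eta> E i p
      by unfold_locales (rule that)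
    obtain v' where "p v' = v" using p_surj by blast
    then obtain f g where "lift E i p v' f g" using lift_exists by blast
    then show ?thesis using standard_form_lift by blast
  qed
  then show ?thesis
    by (intro conjI allI impI; (elim conjE)?)
      (blast, (rule nontrivial_extension; assumption)+,
        (rule exists_nontrivial_extension; assumption), (rule Ext_space_one_dimensional; assumption)+)
qed

end
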